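(* Let $\Sigma$ be an $\bar o$-system of $s$ equations in the variables $X=\{x_1,\dots,x_n\}$ defining a diffiety in some neighborhood of a point $\eta$. Apply the procedure $\bar O$-test to the order matrix $A_\Sigma$, and let $p$ be its number of steps. Let $\Sigma=\bigcup_{h=1}^p\Sigma_h$ be the partition of the equations such that $\Sigma_{p-h+1}$ corresponds to the rows in $R_0$ at step $h$, and let $\Xi_{p-h+1}\subset X$ correspond to the columns in $B$ and not in $C_0$ at step $h$, $1\le h\le p$. Assume that one of the following holds: (a) $\Sigma$ is a dense order $1$ block triangular system; (b) for all $1\le h\le p$ and all $\Sigma'\subset\Sigma_h$ with $\sharp\Sigma'=\sharp\Sigma_h-1$, the Jacobian matrix $\left(\frac{\partial P}{\partial x}(\eta)\mid (P,x)\in\Sigma'\times\Xi_h\right)$ has rank $\sharp\Sigma_h-1$. Then $\Sigma$ is $\bar o$-regular at $\eta$ if and only if, for all $1\le h\le p$, $$\mathrm{rank}\left(\frac{\partial P}{\partial x}(\eta)\ \Big|\ P\in\Sigma_h,\ x\in\Xi_h\right)=\sharp\Sigma_h.$$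
   Context: All functions are analytic. $\mathbf J(\mathbb R,\mathbb R^n)$ is the infinite jet space with coordinates $t$, $x_j^{(k)}$ ($1\le j\le n$, $k\in\mathbb N$) and derivation $d_t=\partial_t+\sum_{j,k}x_j^{(k+1)}\partial/\partial x_j^{(k)}$. A differential system $\Sigma=\{P_1,\dots,P_s\}$ is a finite set of differential functions (analytic functions of finitely many coordinates); near a point $\eta$ where all $d_t^kP_i$ vanish it defines a diffiety, the common zero set of all $d_t^kP_i$. Jacobi numbers. $\mathrm{ord}_{x_j}P$ is the largest $k$ such that $P$ depends on $x_j^{(k)}$, and $-\infty$ if there is none. The order matrix is $A_\Sigma=(a_{i,j})$, $a_{i,j}=\mathrm{ord}_{x_j}P_i$. For a set $E$ of equations and a set $Y$ of variables with $\sharp E\le\sharp Y$, $\mathcal O_{Y,E}=\max_\sigma\sum_{P\in E}\mathrm{ord}_{\sigma(P)}P$ over injections $\sigma:E\to Y$; $\hat{\mathcal O}_\Sigma=\min\{\mathcal O_{Y,\Sigma}:\sharp Y=s,\ \mathcal O_{Y,\Sigma}\ne-\infty\}$. $\Sigma$ is an $\bar o$-system if $\hat{\mathcal O}_\Sigma=0$. Regularity. For $Y$ with $\sharp Y=s$, $\mathcal O_{Y,\Sigma}\ne-\infty$, a canon of $(a_{i,j})_{j\in Y}$ is $\ell\in\mathbb N^s$ such that for some bijection $\sigma_0:\{1,\dots,s\}\to Y$, $a_{i,\sigma_0(i)}+\ell_i=\max_{i'}(a_{i',\sigma_0(i)}+\ell_{i'})$ for all $i$; there is a unique componentwise minimal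 canon $\lambda$. With $\alpha_i=\max_k\lambda_k-\lambda_i$, $\beta_j=\max_i(a_{i,j}-\alpha_i)$, $\nabla_{Y,\Sigma}$ is the determinant of the matrix with entries ($j\in Y$) $\partial P_i/\partial x_j^{(a_{i,j})}$ if $a_{i,j}=\alpha_i+\beta_j$ and $0$ otherwise. An $\bar o$-system is $\bar o$-regular at $\eta$ if there is $Y$ with $\mathcal O_{Y,\Sigma}=0$ and $\nabla_{Y,\Sigma}(\eta)\ne0$. Covers. For a matrix $B$ with entries in $\{0,-\infty\}$ let $r$ be the maximal number of entries $0$ located in pairwise different rows and columns. Among the pairs $(R,C)$ of a set of rows and a set of columns with $\sharp R+\sharp C=r$ such that every entry $0$ lies in a row of $R$ or a column of $C$, there is a unique one $(R_0,C_0)$ with $R_0$ maximal and $C_0$ minimal for inclusion. Procedure $\bar O$-test on a matrix $A$ ($s$ rows, $n$ columns, entries in $\mathbb N\cup\{-\infty\}$): if $A$ has no rows, stop. If $s>n$ or some row contains no entry $0$, fail. Remove all columns containing only $-\infty$. Let $B$ be the submatrix of the columns containing only $0$ or $-\infty$ entries. Compute $(R_0,C_0)$ for $B$. If $R_0=\emptyset$, fail. Otherwise repeat (next step) with the matrix obtained from $A$ by deleting the rows in $R_0$. For an $\bar o$-system the procedure does not fail, and the sets $R_0$ of the successive steps partition the rows. Block triangular systems. An order $1$ block triangular system is a system $\Sigma$ in variables $\Xi$ with partitions $\Sigma=\bigcup_{h=1}^p\Sigma_h$, $\Xi=\bigcup_{h=0}^p\Xi_h$ such that all equations in $\Sigma_i$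 depend only on variables in $\bigcup_{k=0}^i\Xi_k$, are of order $1$ in the variables of $\Xi_{i-1}$ and of order at most $0$ in the other variables, with (i) $\sharp\Xi_{h-1}=\sharp\Sigma_h$; (ii) $\mathcal O_{\Xi_{h-1},\Sigma_h}=\sharp\Xi_{h-1}$; (iii) $\mathcal O_{\Xi_h,\Sigma_h}=0$. It is dense if moreover $\mathrm{ord}_xP=0$ for all $1\le h\le p$ and all $(P,x)\in\Sigma_h\times\Xi_h$. (For such a system the sets $\Sigma_h$, $\Xi_h$, $1\le h\le p$, are those produced by $\bar O$-test with the indexing of the statement.) *)

theory Defs
  imports
    "HOL-Analysis.Analysis"
    "Jordan_Normal_Form.DL_Rank_Submatrix"
begin

hide_const (open) Determinants.det Cartesian_Space.rank

section \<open>Jet space and differential functions\<close>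

text \<open>\<open>Der j k\<close> is the coordinate $x_j^{(k)}$; variables are indexed by \<open>{..<n}\<close>.\<close>

datatype jet_coord = Time | Der nat nat

type_synonym jet = "jet_coord \<Rightarrow> real"

definition coords :: "nat \<Rightarrow> jet_coord set" where
  "coords n = insert Time {Der j k | j k. j < n}"

text \<open>\<open>J(\<real>, \<real>\<^sup>n)\<close>: the coordinates outside \<open>coords n\<close> are unused and fixed to \<open>0\<close>.
  It carries the subspace topology of the product topology.\<close>

definition jets :: "nat \<Rightarrow> jet set" where
  "jets n = {z. \<forall>c. c \<notin> coords n \<longrightarrow> z c = 0}"

text \<open>On \<open>U\<close>, the function \<open>F\<close> factors through the projection to the coordinates in \<open>C\<close> and is,
  near each point, the sum of a power series in them; \<open>m\<close> ranges over the multi-indices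
  supported in \<open>C\<close>.\<close>

definition analytic_in :: "jet_coord set \<Rightarrow> jet set \<Rightarrow> (jet \<Rightarrow> real) \<Rightarrow> bool" where
  "analytic_in C U F \<longleftrightarrow>
     (\<forall>a\<in>U. \<exists>b :: (jet_coord \<Rightarrow> nat) \<Rightarrow> real. \<exists>e>0. \<forall>z\<in>U.
        (\<forall>c\<in>C. \<bar>z c - a c\<bar> < e) \<longrightarrow>
        ((\<lambda>m. b m * (\<Prod>c\<in>C. (z c - a c) ^ m c)) has_sum F z) {m. \<forall>c. c \<notin> C \<longrightarrow> m c = 0})"

definition differential_function :: "nat \<Rightarrow> jet set \<Rightarrow> (jet \<Rightarrow> real) \<Rightarrow> bool" where
  "differential_function n U F \<longleftrightarrow> (\<exists>C. finite C \<and> C \<subseteq> coords n \<and> analytic_in C U F)"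

definition pd :: "jet_coord \<Rightarrow> (jet \<Rightarrow> real) \<Rightarrow> jet \<Rightarrow> real" where
  "pd c F z = deriv (\<lambda>v. F (z(c := v))) (z c)"

text \<open>For a differential function only finitely many terms of the series are nonzero.\<close>

definition d_t :: "nat \<Rightarrow> (jet \<Rightarrow> real) \<Rightarrow> jet \<Rightarrow> real" where
  "d_t n F z = pd Time F z + (\<Sum>j<n. \<Sum>k. z (Der j (Suc k)) * pd (Der j k) F z)"

definition diffiety :: "nat \<Rightarrow> nat \<Rightarrow> jet set \<Rightarrow> (nat \<Rightarrow> jet \<Rightarrow> real) \<Rightarrow> jet set" where
  "diffiety s n U P = {z\<in>U. \<forall>i<s. \<forall>k. (d_t n ^^ k) (P i) z = 0}"

section \<open>Orders and Jacobi numbers\<close>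

text \<open>\<open>F\<close> depends on \<open>c\<close> if it is not locally constant in the direction of \<open>c\<close> on its domain \<open>U\<close>
  (the values of \<open>F\<close> outside the open set \<open>U\<close> are irrelevant).\<close>

definition depends_on :: "jet set \<Rightarrow> (jet \<Rightarrow> real) \<Rightarrow> jet_coord \<Rightarrow> bool" where
  "depends_on U F c \<longleftrightarrow> (\<exists>z\<in>U. \<not> (\<forall>\<^sub>F v in nhds (z c). F (z(c := v)) = F z))"

definition top_order :: "jet set \<Rightarrow> nat \<Rightarrow> (jet \<Rightarrow> real) \<Rightarrow> nat" where
  "top_order U j F = Max {k. depends_on U F (Der j k)}"

definition jet_ord :: "jet set \<Rightarrow> nat \<Rightarrow> (jet \<Rightarrow> real) \<Rightarrow> ereal" where
  "jet_ord U j F = (if \<exists>k. depends_on U F (Der j k) then ereal (real (top_order U j F)) else -\<infinity>)"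

definition order_matrix :: "jet set \<Rightarrow> (nat \<Rightarrow> jet \<Rightarrow> real) \<Rightarrow> nat \<Rightarrow> nat \<Rightarrow> ereal" where
  "order_matrix U P i j = jet_ord U j (P i)"

text \<open>The supremum is a maximum whenever some injection exists, and \<open>-\<infinity>\<close> otherwise.\<close>

definition jacobi_number :: "(nat \<Rightarrow> nat \<Rightarrow> ereal) \<Rightarrow> nat set \<Rightarrow> nat set \<Rightarrow> ereal" where
  "jacobi_number a Y E = (SUP \<sigma>\<in>{\<sigma>. inj_on \<sigma> E \<and> \<sigma> ` E \<subseteq> Y}. \<Sum>i\<in>E. a i (\<sigma> i))"

text \<open>The infimum is a minimum, except that it is \<open>\<infinity>\<close> if no admissible \<open>Y\<close> exists.\<close>

definition obar_number :: "(nat \<Rightarrow> nat \<Rightarrow> ereal) \<Rightarrow> nat \<Rightarrow> nat \<Rightarrow> ereal" where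
  "obar_number a s n =
     (INF Y\<in>{Y. Y \<subseteq> {..<n} \<and> card Y = s \<and> jacobi_number a Y {..<s} \<noteq> -\<infinity>}.
        jacobi_number a Y {..<s})"

definition obar_system :: "nat \<Rightarrow> nat \<Rightarrow> jet set \<Rightarrow> (nat \<Rightarrow> jet \<Rightarrow> real) \<Rightarrow> bool" where
  "obar_system s n U P \<longleftrightarrow> obar_number (order_matrix U P) s n = 0"

section \<open>Canons and regularity\<close>

definition canon :: "(nat \<Rightarrow> nat \<Rightarrow> ereal) \<Rightarrow> nat \<Rightarrow> nat set \<Rightarrow> (nat \<Rightarrow> nat) \<Rightarrow> bool" where
  "canon a s Y l \<longleftrightarrow>
     (\<exists>\<sigma>. bij_betw \<sigma> {..<s} Y \<and>
       (\<forall>i<s. a i (\<sigma> i) + ereal (real (l i)) =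
          Max ((\<lambda>i'. a i' (\<sigma> i) + ereal (real (l i'))) ` {..<s})))"

text \<open>\<open>LEAST\<close> refers to the componentwise order on functions.\<close>

definition min_canon :: "(nat \<Rightarrow> nat \<Rightarrow> ereal) \<Rightarrow> nat \<Rightarrow> nat set \<Rightarrow> nat \<Rightarrow> nat" where
  "min_canon a s Y = (LEAST l. canon a s Y l)"

definition alpha :: "(nat \<Rightarrow> nat \<Rightarrow> ereal) \<Rightarrow> nat \<Rightarrow> nat set \<Rightarrow> nat \<Rightarrow> ereal" where
  "alpha a s Y i = ereal (real (Max (min_canon a s Y ` {..<s}) - min_canon a s Y i))"

definition beta :: "(nat \<Rightarrow> nat \<Rightarrow> ereal) \<Rightarrow> nat \<Rightarrow> nat set \<Rightarrow> nat \<Rightarrow> ereal" where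
  "beta a s Y j = Max ((\<lambda>i. a i j - alpha a s Y i) ` {..<s})"

definition nabla :: "nat \<Rightarrow> nat \<Rightarrow> jet set \<Rightarrow> (nat \<Rightarrow> jet \<Rightarrow> real) \<Rightarrow> nat set \<Rightarrow> jet \<Rightarrow> real" where
  "nabla s n U P Y z =
     (let a = order_matrix U P in
      det (submatrix
        (mat s n (\<lambda>(i, j).
           if a i j = alpha a s Y i + beta a s Y j
           then pd (Der j (top_order U j (P i))) (P i) z else 0))
        {..<s} Y))"

definition obar_regular :: "nat \<Rightarrow> nat \<Rightarrow> jet set \<Rightarrow> (nat \<Rightarrow> jet \<Rightarrow> real) \<Rightarrow> jet \<Rightarrow> bool" where
  "obar_regular s n U P z \<longleftrightarrow>
     (\<exists>Y. Y \<subseteq> {..<n} \<and> card Y = s \<and> jacobi_number (order_matrix U P) Y {..<s} = 0 \<and>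
          nabla s n U P Y z \<noteq> 0)"

section \<open>Covers and the test procedure\<close>

text \<open>\<open>R\<close> and \<open>K\<close> are the sets of rows and columns of a submatrix of \<open>a\<close>.\<close>

definition max_diag_zeros :: "(nat \<Rightarrow> nat \<Rightarrow> ereal) \<Rightarrow> nat set \<Rightarrow> nat set \<Rightarrow> nat" where
  "max_diag_zeros a R K =
     Max {card D | D. D \<subseteq> R \<times> K \<and> (\<forall>(i, j)\<in>D. a i j = 0) \<and> inj_on fst D \<and> inj_on snd D}"

definition min_cover ::
    "(nat \<Rightarrow> nat \<Rightarrow> ereal) \<Rightarrow> nat set \<Rightarrow> nat set \<Rightarrow> nat set \<times> nat set \<Rightarrow> bool" where
  "min_cover a R K = (\<lambda>(R', C').
     R' \<subseteq> R \<and> C' \<subseteq> K \<and> card R' + card C' = max_diag_zeros a R K \<and>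
     (\<forall>i\<in>R. \<forall>j\<in>K. a i j = 0 \<longrightarrow> i \<in> R' \<or> j \<in> C'))"

definition canonical_cover ::
    "(nat \<Rightarrow> nat \<Rightarrow> ereal) \<Rightarrow> nat set \<Rightarrow> nat set \<Rightarrow> nat set \<times> nat set" where
  "canonical_cover a R K =
     (THE X. min_cover a R K X \<and>
        (\<forall>X'. min_cover a R K X' \<longrightarrow> fst X' \<subseteq> fst X \<and> snd X \<subseteq> snd X'))"

text \<open>\<open>None\<close> means failure, which does not happen for the order matrix of an
  \<open>obar_system\<close>; otherwise the result lists, for the successive steps, the row set
  \<open>R\<^sub>0\<close> and the set of columns of \<open>B\<close> that are not in \<open>C\<^sub>0\<close>.\<close>

partial_function (option) obar_test ::
    "(nat \<Rightarrow> nat \<Rightarrow> ereal) \<Rightarrow> nat set \<Rightarrow> nat set \<Rightarrow> (nat set \<times> nat set) list option" where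
  "obar_test a R K =
     (if R = {} then Some []
      else if card R > card K \<or> (\<exists>i\<in>R. \<forall>j\<in>K. a i j \<noteq> 0) then None
      else
        let K' = {j\<in>K. \<exists>i\<in>R. a i j \<noteq> -\<infinity>};
            B = {j\<in>K'. \<forall>i\<in>R. a i j = 0 \<or> a i j = -\<infinity>};
            R0 = fst (canonical_cover a R B);
            C0 = snd (canonical_cover a R B)
        in if R0 = {} then None
           else Option.bind (obar_test a (R - R0) K') (\<lambda>steps. Some ((R0, B - C0) # steps)))"

definition obar_steps ::
    "nat \<Rightarrow> nat \<Rightarrow> jet set \<Rightarrow> (nat \<Rightarrow> jet \<Rightarrow> real) \<Rightarrow> (nat set \<times> nat set) list" where
  "obar_steps s n U P = the (obar_test (order_matrix U P) {..<s} {..<n})"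

text \<open>Blocks are numbered backwards, from \<open>1\<close> for the last step: block \<open>p - h + 1\<close> comes from
  step \<open>h\<close>, which is the list element of index \<open>h - 1\<close>.\<close>

definition eq_block :: "nat \<Rightarrow> nat \<Rightarrow> jet set \<Rightarrow> (nat \<Rightarrow> jet \<Rightarrow> real) \<Rightarrow> nat \<Rightarrow> nat set" where
  "eq_block s n U P h = fst (obar_steps s n U P ! (length (obar_steps s n U P) - h))"

definition var_block :: "nat \<Rightarrow> nat \<Rightarrow> jet set \<Rightarrow> (nat \<Rightarrow> jet \<Rightarrow> real) \<Rightarrow> nat \<Rightarrow> nat set" where
  "var_block s n U P h = snd (obar_steps s n U P ! (length (obar_steps s n U P) - h))"

section \<open>Block triangular systems\<close>

text \<open>The order of an equation in a set of variables is the maximum of its orders in these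
  variables.\<close>

definition block_triangular ::
    "nat \<Rightarrow> nat \<Rightarrow> (nat \<Rightarrow> nat \<Rightarrow> ereal) \<Rightarrow> nat \<Rightarrow> (nat \<Rightarrow> nat set) \<Rightarrow> (nat \<Rightarrow> nat set) \<Rightarrow> bool" where
  "block_triangular s n a p Sig Xi \<longleftrightarrow>
     disjoint_family_on Sig {1..p} \<and> (\<Union>h\<in>{1..p}. Sig h) = {..<s} \<and> (\<forall>h\<in>{1..p}. Sig h \<noteq> {}) \<and>
     disjoint_family_on Xi {0..p} \<and> (\<Union>h\<in>{0..p}. Xi h) = {..<n} \<and>
     (\<forall>h\<in>{1..p}.
        (\<forall>i\<in>Sig h.
           (\<forall>k\<in>{0..p}. \<forall>j\<in>Xi k.
              (h < k \<longrightarrow> a i j = -\<infinity>) \<and> (k \<le> h \<and> k \<noteq> h - 1 \<longrightarrow> a i j \<le> 0)) \<and>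
           (SUP j\<in>Xi (h - 1). a i j) = 1) \<and>
        card (Xi (h - 1)) = card (Sig h) \<and>
        jacobi_number a (Xi (h - 1)) (Sig h) = ereal (real (card (Xi (h - 1)))) \<and>
        jacobi_number a (Xi h) (Sig h) = 0)"

definition dense_block_triangular_system ::
    "nat \<Rightarrow> nat \<Rightarrow> jet set \<Rightarrow> (nat \<Rightarrow> jet \<Rightarrow> real) \<Rightarrow> bool" where
  "dense_block_triangular_system s n U P \<longleftrightarrow>
     (\<exists>p Sig Xi. block_triangular s n (order_matrix U P) p Sig Xi \<and>
        (\<forall>h\<in>{1..p}. \<forall>i\<in>Sig h. \<forall>j\<in>Xi h. order_matrix U P i j = 0))"

section \<open>Jacobian matrices\<close>

definition jac_matrix :: "nat \<Rightarrow> nat \<Rightarrow> (nat \<Rightarrow> jet \<Rightarrow> real) \<Rightarrow> jet \<Rightarrow> real mat" where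
  "jac_matrix s n P z = mat s n (\<lambda>(i, j). pd (Der j 0) (P i) z)"

definition mat_rank :: "real mat \<Rightarrow> nat" where
  "mat_rank M = vec_space.rank (dim_row M) M"

end

theory Submission
  imports Defs
begin

text \<open>Let \<open>a\<close> be the order matrix. Its finite entries are nonnegative, so a set \<open>Y\<close> of \<open>s\<close> columns has
  Jacobi number \<open>0\<close> exactly when it has a transversal of zeros and every transversal with finite
  entries consists of zeros. For such \<open>Y\<close> the minimal canon \<open>\<lambda>\<close> yields \<open>a\<^sub>i\<^sub>j \<le> \<alpha>\<^sub>i + \<beta>\<^sub>j\<close> with
  \<open>\<Sum>\<^sub>i \<alpha>\<^sub>i + \<Sum>\<^sub>j \<beta>\<^sub>j = 0\<close>, and all entries of a transversal satisfy \<open>a\<^sub>i\<^sub>j = \<alpha>\<^sub>i + \<beta>\<^sub>j\<close> if and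
  only if all of them are zeros (\<open>tight_iff_zero\<close>). Hence \<open>\<nabla>\<^sub>Y\<close> is the determinant of the
  derivatives with respect to the variables of order \<open>0\<close>, taken at the zeros of \<open>a\<close>
  (\<open>nabla_eq_det_zero_part\<close>). Only the products along zero transversals enter this determinant,
  so entries that lie on no zero transversal may be erased
  (\<open>det_submatrix_cong_transversals\<close>). In both directions this turns a block triangular matrix into
  a block diagonal one. Full row rank of a block means that its left kernel is trivial.

  A block taken from the test consists of the rows \<open>R\<^sub>0\<close> and of columns whose entries are \<open>0\<close> or
  \<open>-\<infinity>\<close> in the remaining rows and \<open>-\<infinity>\<close> in the rows of all later steps. If all blocks have full
  row rank, then so has the matrix of the diagonal blocks. It therefore contains a nonsingular
  square matrix on some set \<open>Y\<close> of columns; block by block, counting columns shows that every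
  finite transversal of \<open>Y\<close> stays in the diagonal blocks, so \<open>Y\<close> has Jacobi number \<open>0\<close> and
  \<open>\<nabla>\<^sub>Y \<noteq> 0\<close> (\<open>obar_regular_of_blocks\<close>).

  Conversely let \<open>\<nabla>\<^sub>Y \<noteq> 0\<close> and let \<open>v\<close> be in the left kernel of a block. Under (b), a nonzero
  \<open>v\<close> has no zero coordinate. Let \<open>I\<close> be the set of those rows, among the rows that remain at this
  step, where \<open>\<lambda>\<close> is minimal. In the columns that a zero transversal assigns to \<open>I\<close>, the remaining
  rows have zeros only in \<open>I\<close>. Adding \<open>I\<close> to the rows of the canonical cover and dropping these
  columns therefore gives another minimum cover, and maximality of \<open>R\<^sub>0\<close> gives \<open>I \<subseteq> R\<^sub>0\<close>
  (\<open>minimal_rows_in_canonical_cover\<close>, which is also why the test never fails). Along zero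
  transversals \<open>\<lambda>\<close> is constant on the rows that can share a column, so \<open>\<nabla>\<^sub>Y\<close> is block diagonal
  with respect to the values of \<open>\<lambda>\<close>, and the restriction of \<open>v\<close> to \<open>I\<close> is a left kernel vector of it:
  a contradiction (\<open>block_independent_of_regular\<close>). Under (a), no zero transversal leaves the
  blocks. If one did, take among the rows that leave their block one with minimal \<open>\<lambda>\<close>; the entries
  \<open>1\<close> lead from it, block by block, to a row of the same block with smaller \<open>\<lambda>\<close>, which density
  forbids (\<open>dense_transversal_in_blocks\<close>). So \<open>v\<close> itself, extended by zeros, is a left kernel
  vector of \<open>\<nabla>\<^sub>Y\<close> (\<open>dense_block_independent_of_regular\<close>).

  The existence of the canonical cover and of canons both come from the theorem of Koenig on
  matchings and covers; for canons this is the argument of Egervary.\<close>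


section \<open>Matchings and covers\<close>

definition matching :: "('a \<Rightarrow> 'b \<Rightarrow> bool) \<Rightarrow> 'a set \<Rightarrow> 'b set \<Rightarrow> ('a \<times> 'b) set \<Rightarrow> bool" where
  "matching E R K D \<longleftrightarrow> D \<subseteq> R \<times> K \<and> (\<forall>(i, j)\<in>D. E i j) \<and> inj_on fst D \<and> inj_on snd D"

definition covers :: "('a \<Rightarrow> 'b \<Rightarrow> bool) \<Rightarrow> 'a set \<Rightarrow> 'b set \<Rightarrow> 'a set \<Rightarrow> 'b set \<Rightarrow> bool" where
  "covers E R K R' C' \<longleftrightarrow>
     R' \<subseteq> R \<and> C' \<subseteq> K \<and> (\<forall>i\<in>R. \<forall>j\<in>K. E i j \<longrightarrow> i \<in> R' \<or> j \<in> C')"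

lemma matching_finite:
  assumes "matching E R K D" "finite R" "finite K"
  shows "finite D"
proof (rule finite_subset)
  show "D \<subseteq> R \<times> K" using assms(1) by (simp add: matching_def)
qed (use assms in simp)

lemma covers_finite:
  assumes "covers E R K R' C'" "finite R" "finite K"
  shows "finite R'" "finite C'"
proof -
  have "R' \<subseteq> R" "C' \<subseteq> K" using assms(1) by (auto simp: covers_def)
  then show "finite R'" "finite C'" using assms(2,3) by (simp_all add: finite_subset)
qed

text \<open>Each edge of the matching is charged to a covering row or column, and no row or column is charged
  twice.\<close>

lemma card_matching_le_cover:
  assumes fin: "finite R" "finite K" and D: "matching E R K D" and C: "covers E R K R' C'"
  shows "card D \<le> card R' + card C'"
proof -
  note fin' = covers_finite[OF C fin]
  let ?D1 = "{x \<in> D. fst x \<in> R'}" and ?D2 = "{x \<in> D. snd x \<in> C'}"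
  have "D \<subseteq> ?D1 \<union> ?D2"
    using C D unfolding covers_def matching_def by fastforce
  then have "card D \<le> card (?D1 \<union> ?D2)"
    using matching_finite[OF D fin] by (intro card_mono) auto
  also have "\<dots> \<le> card ?D1 + card ?D2"
    by (rule card_Un_le)
  finally have "card D \<le> card ?D1 + card ?D2" .
  moreover have "card ?D1 \<le> card R'"
    using D by (intro card_inj_on_le[of fst] fin') (auto simp: matching_def inj_on_def)
  moreover have "card ?D2 \<le> card C'"
    using D by (intro card_inj_on_le[of snd] fin') (auto simp: matching_def inj_on_def)
  ultimately show ?thesis by linarith
qed

text \<open>The hard half of the theorem of Koenig. A cover \<open>(R', C')\<close> of size \<open>m\<close> cuts the matrix into the
  parts \<open>R' \<times> (K - C')\<close> and \<open>(R - R') \<times> C'\<close>, whose covers have at least \<open>#R'\<close> and \<open>#C'\<close> elements;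
  induction applies if both parts are proper. If no cover of size \<open>m\<close> does that, remove the row and
  the column of some edge. The covers of the rest have at least \<open>m - 1\<close> elements, since one with
  \<open>m - 2\<close> would, together with that row and column, be a cutting cover of size \<open>m\<close>.\<close>

lemma matching_of_cover_bound:
  fixes R :: "'a set" and K :: "'b set"
  assumes "finite R" "finite K"
    and "\<And>R' C'. covers E R K R' C' \<Longrightarrow> m \<le> card R' + card C'"
  shows "\<exists>D. matching E R K D \<and> m \<le> card D"
  using assms
proof (induction "card R + card K" arbitrary: R K m rule: less_induct)
  case less
  note fin = less.prems(1,2) and bound = less.prems(3)
  show ?case
  proof (cases "\<exists>R' C'. covers E R K R' C' \<and> card R' + card C' = m
      \<and> (R' \<noteq> R \<or> C' \<noteq> {}) \<and> (R' \<noteq> {} \<or> C' \<noteq> K)")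
    case True
    then obtain R' C' where C: "covers E R K R' C'" and m: "card R' + card C' = m"
      and proper: "R' \<noteq> R \<or> C' \<noteq> {}" "R' \<noteq> {} \<or> C' \<noteq> K" by blast
    have sub: "R' \<subseteq> R" "C' \<subseteq> K" using C by (auto simp: covers_def)
    have fin': "finite R'" "finite C'" using sub fin finite_subset by blast+
    have split_card: "card R = card R' + card (R - R')" "card K = card C' + card (K - C')"
      using sub fin fin' by (simp_all add: card_Diff_subset card_mono)
    have smaller1: "card R' + card (K - C') < card R + card K"
      using proper(1) split_card sub fin fin' by (auto simp: card_gt_0_iff)
    have smaller2: "card (R - R') + card C' < card R + card K"
      using proper(2) split_card sub fin fin' by (auto simp: card_gt_0_iff)
    have "\<exists>D. matching E R' (K - C') D \<and> card R' \<le> card D"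
    proof (rule less.hyps[OF smaller1])
      fix A B assume AB: "covers E R' (K - C') A B"
      have "covers E R K A (B \<union> C')"
        using AB C unfolding covers_def by blast
      from bound[OF this] m card_Un_le[of B C'] show "card R' \<le> card A + card B" by linarith
    qed (use fin fin' in auto)
    then obtain D1 where D1: "matching E R' (K - C') D1" "card R' \<le> card D1" by blast
    have "\<exists>D. matching E (R - R') C' D \<and> card C' \<le> card D"
    proof (rule less.hyps[OF smaller2])
      fix A B assume AB: "covers E (R - R') C' A B"
      have "covers E R K (A \<union> R') B"
        using AB C unfolding covers_def by blast
      from bound[OF this] m card_Un_le[of A R'] show "card C' \<le> card A + card B" by linarith
    qed (use fin fin' in auto)
    then obtain D2 where D2: "matching E (R - R') C' D2" "card C' \<le> card D2" by blast
    have "matching E R K (D1 \<union> D2)"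
    proof -
      have "fst ` D1 \<inter> fst ` D2 = {}" "snd ` D1 \<inter> snd ` D2 = {}"
        using D1(1) D2(1) unfolding matching_def by auto
      then have "inj_on fst (D1 \<union> D2)" "inj_on snd (D1 \<union> D2)"
        using D1(1) D2(1) unfolding matching_def by (auto simp: inj_on_Un)
      then show ?thesis
        using D1(1) D2(1) sub unfolding matching_def by auto
    qed
    moreover have "card (D1 \<union> D2) = card D1 + card D2"
    proof (rule card_Un_disjoint)
      show "finite D1" "finite D2"
        using D1(1) D2(1) fin fin' matching_finite by blast+
      show "D1 \<inter> D2 = {}" using D1(1) D2(1) unfolding matching_def by blast
    qed
    ultimately have "matching E R K (D1 \<union> D2) \<and> m \<le> card (D1 \<union> D2)"
      using D1(2) D2(2) m by simp
    then show ?thesis by blast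
  next
    case False
    show ?thesis
    proof (cases "m = 0")
      case True
      then show ?thesis by (intro exI[of _ "{}"]) (auto simp: matching_def)
    next
      case m0: False
      have "\<not> covers E R K {} {}" using bound m0 by fastforce
      then obtain i j where ij: "i \<in> R" "j \<in> K" "E i j" unfolding covers_def by blast
      have "\<exists>D. matching E (R - {i}) (K - {j}) D \<and> m - 1 \<le> card D"
      proof (rule less.hyps)
        show "card (R - {i}) + card (K - {j}) < card R + card K"
          using ij fin by (intro add_less_mono card_Diff1_less) auto
        fix A B assume AB: "covers E (R - {i}) (K - {j}) A B"
        have C: "covers E R K (insert i A) (insert j B)"
          using AB ij unfolding covers_def by blast
        have "finite A" "finite B" "i \<notin> A" "j \<notin> B"
          using covers_finite[OF AB] AB fin by (auto simp: covers_def)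
        then have "card (insert i A) + card (insert j B) = card A + card B + 2" by simp
        moreover have "card (insert i A) + card (insert j B) \<noteq> m" using False C by blast
        ultimately show "m - 1 \<le> card A + card B" using bound[OF C] by linarith
      qed (use fin in auto)
      then obtain D where D: "matching E (R - {i}) (K - {j}) D" "m - 1 \<le> card D" by blast
      have "matching E R K (insert (i, j) D)"
      proof -
        have "i \<notin> fst ` D" "j \<notin> snd ` D" using D(1) unfolding matching_def by auto
        then have "inj_on fst (insert (i, j) D)" "inj_on snd (insert (i, j) D)"
          using D(1) unfolding matching_def by auto
        then show ?thesis using D(1) ij unfolding matching_def by auto
      qed
      moreover have "card (insert (i, j) D) = Suc (card D)"
        using D(1) matching_finite[OF D(1)] fin
        by (subst card_insert_disjoint) (auto simp: matching_def)
      ultimately have "matching E R K (insert (i, j) D) \<and> m \<le> card (insert (i, j) D)"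
        using D(2) by simp
      then show ?thesis by blast
    qed
  qed
qed

theorem koenig:
  assumes "finite R" "finite K"
  obtains D R' C' where "matching E R K D" "covers E R K R' C'" "card D = card R' + card C'"
proof -
  let ?m = "LEAST m. \<exists>R' C'. covers E R K R' C' \<and> card R' + card C' = m"
  have "covers E R K R K" by (auto simp: covers_def)
  then have "\<exists>m R' C'. covers E R K R' C' \<and> card R' + card C' = m" by blast
  then obtain R' C' where C: "covers E R K R' C'" "card R' + card C' = ?m"
    using LeastI_ex[of "\<lambda>m. \<exists>R' C'. covers E R K R' C' \<and> card R' + card C' = m"] by blast
  have "\<And>R' C'. covers E R K R' C' \<Longrightarrow> ?m \<le> card R' + card C'"
    by (rule Least_le) blast
  from matching_of_cover_bound[OF assms this] obtain D where
    D: "matching E R K D" "?m \<le> card D" by blast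
  with card_matching_le_cover[OF assms D(1) C(1)] C(2) have "card D = card R' + card C'" by simp
  with D(1) C(1) show thesis by (rule that)
qed

section \<open>The canonical cover\<close>

lemma min_cover_iff:
  "min_cover a R K (R', C') \<longleftrightarrow>
     covers (\<lambda>i j. a i j = 0) R K R' C' \<and> card R' + card C' = max_diag_zeros a R K"
  by (auto simp: min_cover_def covers_def)

lemma max_diag_zeros_eq:
  assumes fin: "finite R" "finite K" and D: "matching (\<lambda>i j. a i j = 0) R K D"
    and C: "covers (\<lambda>i j. a i j = 0) R K R' C'" and eq: "card D = card R' + card C'"
  shows "max_diag_zeros a R K = card D"
proof -
  let ?S = "{card D | D. matching (\<lambda>i j. a i j = 0) R K D}"
  have upper: "d \<le> card D" if "d \<in> ?S" for d
  proof -
    from that obtain D' where "d = card D'" and D': "matching (\<lambda>i j. a i j = 0) R K D'" by blast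
    with card_matching_le_cover[OF fin D' C] eq show ?thesis by simp
  qed
  have "finite ?S" by (rule finite_subset[of _ "{..card D}"]) (use upper in blast, simp)
  moreover have "card D \<in> ?S" using D by blast
  ultimately have "Max ?S = card D" using upper by (intro Max_eqI)
  then show ?thesis by (simp add: max_diag_zeros_def matching_def)
qed

lemma max_diag_zeros_le_cover:
  assumes fin: "finite R" "finite K" and C: "covers (\<lambda>i j. a i j = 0) R K R' C'"
  shows "max_diag_zeros a R K \<le> card R' + card C'"
proof -
  obtain D A B where D: "matching (\<lambda>i j. a i j = 0) R K D"
    and AB: "covers (\<lambda>i j. a i j = 0) R K A B" "card D = card A + card B"
    by (rule koenig[OF fin, of "\<lambda>i j. a i j = 0"])
  show ?thesis
    unfolding max_diag_zeros_eq[OF fin D AB] by (rule card_matching_le_cover[OF fin D C])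
qed

text \<open>The description that determines \<open>canonical_cover\<close>.\<close>

definition is_canonical ::
    "(nat \<Rightarrow> nat \<Rightarrow> ereal) \<Rightarrow> nat set \<Rightarrow> nat set \<Rightarrow> nat set \<times> nat set \<Rightarrow> bool" where
  "is_canonical a R K X \<longleftrightarrow> min_cover a R K X \<and>
     (\<forall>X'. min_cover a R K X' \<longrightarrow> fst X' \<subseteq> fst X \<and> snd X \<subseteq> snd X')"

lemma is_canonical_unique:
  assumes "is_canonical a R K X" "is_canonical a R K X'"
  shows "X = X'"
proof (rule prod_eqI)
  show "fst X = fst X'" "snd X = snd X'"
    using assms unfolding is_canonical_def by (meson subset_antisym)+
qed

text \<open>The dual pair \<open>(R1 \<inter> R2, C1 \<union> C2)\<close> is a cover too, and the sizes of the two pairs add up to twice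
  the minimum.\<close>

lemma min_cover_Un_Int:
  assumes fin: "finite R" "finite K"
    and m: "min_cover a R K (R1, C1)" "min_cover a R K (R2, C2)"
  shows "min_cover a R K (R1 \<union> R2, C1 \<inter> C2)"
proof -
  have cov: "covers (\<lambda>i j. a i j = 0) R K (R1 \<union> R2) (C1 \<inter> C2)"
    "covers (\<lambda>i j. a i j = 0) R K (R1 \<inter> R2) (C1 \<union> C2)"
    using m unfolding min_cover_iff covers_def by blast+
  have "finite R1" "finite R2" "finite C1" "finite C2"
    using m fin covers_finite unfolding min_cover_iff by blast+
  then have "card R1 + card R2 = card (R1 \<union> R2) + card (R1 \<inter> R2)"
    "card C1 + card C2 = card (C1 \<union> C2) + card (C1 \<inter> C2)"
    using card_Un_Int by blast+
  moreover have "card R1 + card C1 = max_diag_zeros a R K" "card R2 + card C2 = max_diag_zeros a R K"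
    using m by (simp_all add: min_cover_iff)
  ultimately have "card (R1 \<union> R2) + card (C1 \<inter> C2) = max_diag_zeros a R K"
    using max_diag_zeros_le_cover[OF fin cov(1)] max_diag_zeros_le_cover[OF fin cov(2)] by linarith
  with cov(1) show ?thesis by (simp add: min_cover_iff)
qed

lemma is_canonical_canonical_cover:
  assumes fin: "finite R" "finite K"
  shows "is_canonical a R K (canonical_cover a R K)"
proof -
  let ?S = "{X. min_cover a R K X}"
  obtain D A B where DAB: "matching (\<lambda>i j. a i j = 0) R K D" "covers (\<lambda>i j. a i j = 0) R K A B"
    "card D = card A + card B"
    by (rule koenig[OF fin, of "\<lambda>i j. a i j = 0"])
  then have ne: "(A, B) \<in> ?S"
    using max_diag_zeros_eq[OF fin DAB] by (simp add: min_cover_iff)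
  have "?S \<subseteq> Pow R \<times> Pow K" by (auto simp: min_cover_def)
  moreover have "finite (Pow R \<times> Pow K)" using fin by simp
  ultimately have "finite ?S" by (rule finite_subset)
  with ne have "Max ((card \<circ> fst) ` ?S) \<in> (card \<circ> fst) ` ?S"
    by (intro Max_in) auto
  then obtain X where X: "X \<in> ?S" and "Max ((card \<circ> fst) ` ?S) = card (fst X)" by auto
  with \<open>finite ?S\<close> have maxi: "\<And>Y. min_cover a R K Y \<Longrightarrow> card (fst Y) \<le> card (fst X)"
    by (metis Max_ge comp_apply finite_imageI image_eqI mem_Collect_eq)
  obtain R0 C0 where X_eq: "X = (R0, C0)" by force
  have "R' \<subseteq> R0 \<and> C0 \<subseteq> C'" if Y: "min_cover a R K (R', C')" for R' C'
  proof -
    have m0: "min_cover a R K (R0, C0)" using X X_eq by simp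
    note m = min_cover_Un_Int[OF fin m0 Y]
    have fins: "finite (R0 \<union> R')" "finite C0"
      using m0 Y fin covers_finite unfolding min_cover_iff by blast+
    have le: "card (R0 \<union> R') \<le> card R0" using maxi[OF m] X_eq by simp
    then have R: "R0 = R0 \<union> R'" by (intro card_seteq fins) auto
    have "card (C0 \<inter> C') = card C0" using m m0 R unfolding min_cover_iff by simp
    then have "C0 \<inter> C' = C0" using fins by (intro card_subset_eq) auto
    with R show ?thesis by blast
  qed
  then have can: "is_canonical a R K X" using X X_eq by (auto simp: is_canonical_def)
  have "canonical_cover a R K = X"
    unfolding canonical_cover_def is_canonical_def[symmetric]
    using can is_canonical_unique by blast
  with can show ?thesis by simp
qed


section \<open>Optimal assignments\<close>

text \<open>Duality for the assignment problem in the special case where the identity is an optimal permutation.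
  Here \<open>E\<close> singles out the finite entries. Among the integral pairs \<open>(\<mu>, \<nu>)\<close> with
  \<open>w i j \<le> \<mu> i + \<nu> j\<close> take one with minimal total. If its tight entries had no perfect matching, a
  cover of them with fewer than \<open>#T\<close> elements would allow one to lower the total. A perfect matching
  is a permutation of weight equal to the total, so the total is \<open>0\<close>, and the diagonal entries then
  force \<open>\<nu> = - \<mu>\<close>.\<close>

lemma egervary:
  fixes w :: "'a \<Rightarrow> 'a \<Rightarrow> int"
  assumes fin: "finite T" and diag: "\<And>i. i \<in> T \<Longrightarrow> E i i \<and> w i i = 0"
    and perm: "\<And>\<pi>. \<pi> permutes T \<Longrightarrow> (\<And>i. i \<in> T \<Longrightarrow> E i (\<pi> i)) \<Longrightarrow> (\<Sum>i\<in>T. w i (\<pi> i)) \<le> 0"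
  obtains l :: "'a \<Rightarrow> int" where "\<And>i j. i \<in> T \<Longrightarrow> j \<in> T \<Longrightarrow> E i j \<Longrightarrow> w i j + l i \<le> l j"
proof -
  define feasible where "feasible = (\<lambda>(\<mu>, \<nu>). \<forall>i\<in>T. \<forall>j\<in>T. E i j \<longrightarrow> w i j \<le> \<mu> i + \<nu> j)"
  define val where "val = (\<lambda>(\<mu>, \<nu>). \<Sum>i\<in>T. \<mu> i + \<nu> i :: int)"
  have val_nonneg: "0 \<le> val (\<mu>, \<nu>)" if "feasible (\<mu>, \<nu>)" for \<mu> \<nu>
    unfolding val_def prod.case using that diag unfolding feasible_def
    by (intro sum_nonneg) fastforce
  have "feasible (\<lambda>i. \<Sum>j\<in>T. \<bar>w i j\<bar>, \<lambda>j. 0)"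
    unfolding feasible_def prod.case
  proof (intro ballI impI)
    fix i j assume "i \<in> T" "j \<in> T"
    have "\<bar>w i j\<bar> \<le> (\<Sum>j\<in>T. \<bar>w i j\<bar>)" by (rule member_le_sum) (use fin \<open>j \<in> T\<close> in auto)
    then show "w i j \<le> (\<Sum>j\<in>T. \<bar>w i j\<bar>) + 0" by linarith
  qed
  from ex_has_least_nat[of feasible, OF this, of "\<lambda>x. nat (val x)"]
  obtain x where x: "feasible x" and "\<And>y. feasible y \<Longrightarrow> nat (val x) \<le> nat (val y)" by blast
  moreover obtain \<mu> \<nu> where x_eq: "x = (\<mu>, \<nu>)" by force
  ultimately have feas: "feasible (\<mu>, \<nu>)"
    and least: "\<And>\<mu>' \<nu>'. feasible (\<mu>', \<nu>') \<Longrightarrow> val (\<mu>, \<nu>) \<le> val (\<mu>', \<nu>')"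
    using val_nonneg by (simp, metis nat_le_eq_zle nat_eq_iff order.trans linorder_not_le)
  define G where "G i j \<longleftrightarrow> E i j \<and> w i j = \<mu> i + \<nu> j" for i j
  obtain D R' C' where D: "matching G T T D" and C: "covers G T T R' C'"
    and card_D: "card D = card R' + card C'"
    by (rule koenig[OF fin fin, of G])
  have sub: "R' \<subseteq> T" "C' \<subseteq> T" using C by (auto simp: covers_def)
  have D_sub: "D \<subseteq> T \<times> T" and inj: "inj_on fst D" "inj_on snd D"
    and DG: "\<And>i j. (i, j) \<in> D \<Longrightarrow> G i j" using D by (auto simp: matching_def)
  have "card T \<le> card D"
  proof -
    \<comment> \<open>lower the uncovered rows by one and raise the covering columns by one\<close>
    let ?\<mu> = "\<lambda>i. \<mu> i - (if i \<in> R' then 0 else 1)" and ?\<nu> = "\<lambda>j. \<nu> j + (if j \<in> C' then 1 else 0)"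
    have "feasible (?\<mu>, ?\<nu>)"
      unfolding feasible_def prod.case
    proof (intro ballI impI)
      fix i j assume ij: "i \<in> T" "j \<in> T" "E i j"
      then have "w i j \<le> \<mu> i + \<nu> j" using feas by (auto simp: feasible_def)
      moreover have "i \<in> R' \<or> j \<in> C' \<or> w i j \<noteq> \<mu> i + \<nu> j"
        using C ij by (auto simp: covers_def G_def)
      ultimately show "w i j \<le> ?\<mu> i + ?\<nu> j" by auto
    qed
    from least[OF this] have "0 \<le> (\<Sum>i\<in>T. (if i \<in> C' then 1 else 0) - (if i \<in> R' then 0 else 1 :: int))"
      unfolding val_def prod.case by (simp add: sum.distrib sum_subtractf)
    also have "\<dots> = (\<Sum>i\<in>T. (if i \<in> C' then 1 else 0) + (if i \<in> R' then 1 else 0) - 1 :: int)"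
      by (rule sum.cong) auto
    also have "\<dots> = int (card C') + int (card R') - int (card T)"
      using fin sub by (simp add: sum.distrib sum_subtractf sum.If_cases Int_absorb1)
    finally show ?thesis using card_D by linarith
  qed
  have img: "fst ` D = T" "snd ` D = T"
  proof -
    have "card (fst ` D) = card D" "card (snd ` D) = card D" using inj by (simp_all add: card_image)
    moreover have "fst ` D \<subseteq> T" "snd ` D \<subseteq> T" using D_sub by auto
    ultimately show "fst ` D = T" "snd ` D = T"
      using \<open>card T \<le> card D\<close> fin by (simp_all add: card_seteq)
  qed
  define \<pi> where "\<pi> i = (if i \<in> T then snd (inv_into D fst i) else i)" for i
  have in_D: "(i, \<pi> i) \<in> D" if "i \<in> T" for i
  proof -
    have "inv_into D fst i \<in> D" "fst (inv_into D fst i) = i"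
      using that img(1) by (auto intro: inv_into_into f_inv_into_f)
    then show ?thesis using that by (metis \<pi>_def prod.collapse)
  qed
  have "bij_betw \<pi> T T"
  proof -
    have "inj_on \<pi> T"
    proof (rule inj_onI)
      fix i k assume ik: "i \<in> T" "k \<in> T" "\<pi> i = \<pi> k"
      have "(i, \<pi> i) = (k, \<pi> k)"
        by (rule inj_onD[OF inj(2) _ in_D[OF ik(1)] in_D[OF ik(2)]]) (use ik(3) in simp)
      then show "i = k" by simp
    qed
    moreover have "\<pi> ` T \<subseteq> T" using in_D D_sub by blast
    ultimately show ?thesis using fin by (simp add: bij_betw_def endo_inj_surj)
  qed
  then have \<pi>: "\<pi> permutes T"
    by (rule bij_imp_permutes) (simp add: \<pi>_def)
  have tight: "E i (\<pi> i) \<and> w i (\<pi> i) = \<mu> i + \<nu> (\<pi> i)" if "i \<in> T" for i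
    using DG[OF in_D[OF that]] by (simp add: G_def)
  have "(\<Sum>i\<in>T. \<mu> i + \<nu> i) = (\<Sum>i\<in>T. \<mu> i) + (\<Sum>i\<in>T. \<nu> (\<pi> i))"
    using sum.permute[OF \<pi>, of \<nu>] by (simp add: sum.distrib)
  also have "\<dots> = (\<Sum>i\<in>T. w i (\<pi> i))"
    unfolding sum.distrib[symmetric] by (rule sum.cong) (use tight in auto)
  also have "\<dots> \<le> 0" using perm[OF \<pi>] tight by blast
  finally have "(\<Sum>i\<in>T. \<mu> i + \<nu> i) = 0" using val_nonneg[OF feas] by (simp add: val_def)
  moreover have "0 \<le> \<mu> i + \<nu> i" if "i \<in> T" for i
    using feas diag[OF that] that by (fastforce simp: feasible_def)
  ultimately have zero: "\<mu> i + \<nu> i = 0" if "i \<in> T" for i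
    using that sum_nonneg_eq_0_iff[OF fin, of "\<lambda>i. \<mu> i + \<nu> i"] by blast
  show thesis
  proof (rule that[of "\<lambda>i. - \<mu> i"])
    fix i j assume ij: "i \<in> T" "j \<in> T" "E i j"
    then have "w i j \<le> \<mu> i + \<nu> j" using feas by (auto simp: feasible_def)
    with zero[OF \<open>j \<in> T\<close>] show "w i j + - \<mu> i \<le> - \<mu> j" by linarith
  qed
qed

section \<open>Order matrices\<close>

locale nat_order_matrix =
  fixes a :: "nat \<Rightarrow> nat \<Rightarrow> ereal"
  assumes entry: "a i j = -\<infinity> \<or> (\<exists>k::nat. a i j = ereal (real k))"
begin

text \<open>A finite entry as a natural number; the value for \<open>-\<infinity>\<close> is arbitrary.\<close>

definition ordn :: "nat \<Rightarrow> nat \<Rightarrow> nat" where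
  "ordn i j = (SOME k. a i j = ereal (real k))"

lemma finite_entry: "a i j \<noteq> -\<infinity> \<Longrightarrow> a i j = ereal (real (ordn i j))"
  unfolding ordn_def by (rule someI_ex) (use entry in blast)

lemma sum_entries:
  assumes "finite E"
  shows "(\<Sum>i\<in>E. a i (\<sigma> i)) =
    (if \<forall>i\<in>E. a i (\<sigma> i) \<noteq> -\<infinity> then ereal (real (\<Sum>i\<in>E. ordn i (\<sigma> i))) else -\<infinity>)"
  using assms
proof (induction E rule: finite_induct)
  case (insert x F)
  show ?case
  proof (cases "a x (\<sigma> x) = -\<infinity>")
    case True
    then show ?thesis using insert by auto
  next
    case False
    note finite_entry[OF False]
    then show ?thesis using insert False by auto
  qed
qed simp

definition zero_transversal :: "nat set \<Rightarrow> nat set \<Rightarrow> (nat \<Rightarrow> nat) \<Rightarrow> bool" where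
  "zero_transversal E Y \<sigma> \<longleftrightarrow> inj_on \<sigma> E \<and> \<sigma> ` E \<subseteq> Y \<and> (\<forall>i\<in>E. a i (\<sigma> i) = 0)"

definition no_positive_transversal :: "nat set \<Rightarrow> nat set \<Rightarrow> bool" where
  "no_positive_transversal E Y \<longleftrightarrow>
     (\<forall>\<tau>. inj_on \<tau> E \<and> \<tau> ` E \<subseteq> Y \<and> (\<forall>i\<in>E. a i (\<tau> i) \<noteq> -\<infinity>) \<longrightarrow> (\<forall>i\<in>E. a i (\<tau> i) = 0))"

lemma no_positive_transversal_zero:
  assumes "no_positive_transversal E Y" "inj_on \<tau> E" "\<tau> ` E \<subseteq> Y"
    and "\<And>i. i \<in> E \<Longrightarrow> a i (\<tau> i) \<noteq> -\<infinity>" "i \<in> E"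
  shows "a i (\<tau> i) = 0"
  using assms unfolding no_positive_transversal_def by blast

lemma jacobi_number_attained:
  assumes fin: "finite E" "finite Y" and J: "jacobi_number a Y E \<noteq> -\<infinity>"
  obtains \<sigma> where "inj_on \<sigma> E" "\<sigma> ` E \<subseteq> Y" "(\<Sum>i\<in>E. a i (\<sigma> i)) = jacobi_number a Y E"
proof -
  let ?S = "{\<sigma>. inj_on \<sigma> E \<and> \<sigma> ` E \<subseteq> Y}" and ?f = "\<lambda>\<sigma>. \<Sum>i\<in>E. a i (\<sigma> i)"
  have ne: "?f ` ?S \<noteq> {}"
  proof
    assume "?f ` ?S = {}"
    with J show False unfolding jacobi_number_def by (simp add: bot_ereal_def)
  qed
  have finS: "finite (?f ` ?S)"
  proof (rule finite_subset)
    show "?f ` ?S \<subseteq> ?f ` (E \<rightarrow>\<^sub>E Y)"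
    proof
      fix v assume "v \<in> ?f ` ?S"
      then obtain \<sigma> where \<sigma>: "\<sigma> ` E \<subseteq> Y" "v = ?f \<sigma>" by blast
      have "v = ?f (restrict \<sigma> E)" unfolding \<sigma>(2) by (rule sum.cong) auto
      moreover have "restrict \<sigma> E \<in> E \<rightarrow>\<^sub>E Y" using \<sigma>(1) by auto
      ultimately show "v \<in> ?f ` (E \<rightarrow>\<^sub>E Y)" by blast
    qed
    show "finite (?f ` (E \<rightarrow>\<^sub>E Y))" using fin by (intro finite_imageI finite_PiE)
  qed
  have "Sup (?f ` ?S) \<in> ?f ` ?S"
    using Max_in[OF finS ne] unfolding Max_Sup[OF finS ne] .
  then have "jacobi_number a Y E \<in> ?f ` ?S" unfolding jacobi_number_def .
  then show thesis
  proof (rule imageE)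
    fix \<sigma> assume "jacobi_number a Y E = ?f \<sigma>" "\<sigma> \<in> ?S"
    then show thesis by (intro that[of \<sigma>]) simp_all
  qed
qed

lemma jacobi_number_upper:
  assumes "inj_on \<sigma> E" "\<sigma> ` E \<subseteq> Y"
  shows "(\<Sum>i\<in>E. a i (\<sigma> i)) \<le> jacobi_number a Y E"
  unfolding jacobi_number_def by (rule SUP_upper) (use assms in simp)

text \<open>Finite entries are nonnegative, so a sum of them is \<open>0\<close>, or at most \<open>0\<close>, only if all of them are \<open>0\<close>.\<close>

lemma jacobi_number_eq_0_iff:
  assumes fin: "finite E" "finite Y"
  shows "jacobi_number a Y E = 0 \<longleftrightarrow>
    (\<exists>\<sigma>. zero_transversal E Y \<sigma>) \<and> no_positive_transversal E Y"
proof
  assume J: "jacobi_number a Y E = 0"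
  have all0: "\<forall>i\<in>E. a i (\<sigma> i) = 0"
    if "(\<Sum>i\<in>E. a i (\<sigma> i)) \<le> 0" and finite_entries: "\<forall>i\<in>E. a i (\<sigma> i) \<noteq> -\<infinity>" for \<sigma>
  proof -
    from that have "real (\<Sum>i\<in>E. ordn i (\<sigma> i)) \<le> 0" by (simp add: sum_entries[OF fin(1)])
    then have "(\<Sum>i\<in>E. ordn i (\<sigma> i)) = 0" by linarith
    then have "\<forall>i\<in>E. ordn i (\<sigma> i) = 0" using fin by simp
    then show ?thesis using finite_entries finite_entry by (metis of_nat_0 zero_ereal_def)
  qed
  have "jacobi_number a Y E \<noteq> -\<infinity>" using J by simp
  from jacobi_number_attained[OF fin this] obtain \<sigma> where
    \<sigma>: "inj_on \<sigma> E" "\<sigma> ` E \<subseteq> Y" "(\<Sum>i\<in>E. a i (\<sigma> i)) = 0" using J by metis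
  then have "\<forall>i\<in>E. a i (\<sigma> i) \<noteq> -\<infinity>" by (auto simp: sum_entries[OF fin(1)] split: if_splits)
  with all0[of \<sigma>] \<sigma> have "zero_transversal E Y \<sigma>" by (simp add: zero_transversal_def)
  moreover have "no_positive_transversal E Y"
    unfolding no_positive_transversal_def
  proof (intro allI impI)
    fix \<tau> assume \<tau>: "inj_on \<tau> E \<and> \<tau> ` E \<subseteq> Y \<and> (\<forall>i\<in>E. a i (\<tau> i) \<noteq> -\<infinity>)"
    then have "(\<Sum>i\<in>E. a i (\<tau> i)) \<le> 0" using jacobi_number_upper[of \<tau> E Y] J by simp
    with \<tau> show "\<forall>i\<in>E. a i (\<tau> i) = 0" using all0 by blast
  qed
  ultimately show "(\<exists>\<sigma>. zero_transversal E Y \<sigma>) \<and> no_positive_transversal E Y" by blast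
next
  assume R: "(\<exists>\<sigma>. zero_transversal E Y \<sigma>) \<and> no_positive_transversal E Y"
  then obtain \<sigma> where "zero_transversal E Y \<sigma>" by blast
  then have "inj_on \<sigma> E" "\<sigma> ` E \<subseteq> Y" "(\<Sum>i\<in>E. a i (\<sigma> i)) = 0"
    by (simp_all add: zero_transversal_def)
  with jacobi_number_upper[of \<sigma> E Y] have "0 \<le> jacobi_number a Y E" by simp
  moreover have "jacobi_number a Y E \<le> 0"
    unfolding jacobi_number_def
  proof (rule SUP_least)
    fix \<tau> assume "\<tau> \<in> {\<sigma>. inj_on \<sigma> E \<and> \<sigma> ` E \<subseteq> Y}"
    then have zero: "(\<forall>i\<in>E. a i (\<tau> i) \<noteq> -\<infinity>) \<longrightarrow> (\<forall>i\<in>E. a i (\<tau> i) = 0)"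
      using R unfolding no_positive_transversal_def by blast
    show "(\<Sum>i\<in>E. a i (\<tau> i)) \<le> 0"
    proof (cases "\<forall>i\<in>E. a i (\<tau> i) \<noteq> -\<infinity>")
      case True
      with zero show ?thesis by simp
    next
      case False
      then have "(\<Sum>i\<in>E. a i (\<tau> i)) = -\<infinity>"
        unfolding sum_entries[OF fin(1)] by (rule if_not_P)
      then show ?thesis by simp
    qed
  qed
  ultimately show "jacobi_number a Y E = 0" by simp
qed

text \<open>For a zero transversal \<open>\<sigma>\<close> this is the defining inequality of a canon, as
  \<open>a k (\<sigma> k) + l k = l k\<close>.\<close>

definition potential :: "nat set \<Rightarrow> (nat \<Rightarrow> nat) \<Rightarrow> (nat \<Rightarrow> nat) \<Rightarrow> bool" where
  "potential T \<sigma> l \<longleftrightarrow>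
     (\<forall>i\<in>T. \<forall>k\<in>T. a i (\<sigma> k) + ereal (real (l i)) \<le> ereal (real (l k)))"

lemma potential_finite_entry:
  assumes "potential T \<sigma> l" "i \<in> T" "k \<in> T" "a i (\<sigma> k) \<noteq> -\<infinity>"
  shows "ordn i (\<sigma> k) + l i \<le> l k"
proof -
  have "a i (\<sigma> k) + ereal (real (l i)) \<le> ereal (real (l k))"
    using assms by (simp add: potential_def)
  then show ?thesis unfolding finite_entry[OF assms(4)] by simp
qed

lemma potentialI:
  assumes "\<And>i k. i \<in> T \<Longrightarrow> k \<in> T \<Longrightarrow> a i (\<sigma> k) \<noteq> -\<infinity> \<Longrightarrow> ordn i (\<sigma> k) + l i \<le> l k"
  shows "potential T \<sigma> l"
  unfolding potential_def
proof (intro ballI)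
  fix i k assume "i \<in> T" "k \<in> T"
  show "a i (\<sigma> k) + ereal (real (l i)) \<le> ereal (real (l k))"
  proof (cases "a i (\<sigma> k) = -\<infinity>")
    case False
    with assms[OF \<open>i \<in> T\<close> \<open>k \<in> T\<close>] show ?thesis unfolding finite_entry[OF False] by simp
  qed simp
qed

lemma potential_exists:
  assumes fin: "finite T" and \<sigma>: "zero_transversal T Y \<sigma>"
    and npt: "no_positive_transversal T (\<sigma> ` T)"
  obtains l where "potential T \<sigma> l"
proof -
  have inj: "inj_on \<sigma> T" and zero: "\<And>i. i \<in> T \<Longrightarrow> a i (\<sigma> i) = 0"
    using \<sigma> by (auto simp: zero_transversal_def)
  have ordn0: "ordn i j = 0" if "a i j = 0" for i j
    using finite_entry[of i j] that by (simp add: zero_ereal_def)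
  obtain l :: "nat \<Rightarrow> int" where
    l: "\<And>i k. i \<in> T \<Longrightarrow> k \<in> T \<Longrightarrow> a i (\<sigma> k) \<noteq> -\<infinity> \<Longrightarrow> int (ordn i (\<sigma> k)) + l i \<le> l k"
  proof (rule egervary[OF fin, of "\<lambda>i k. a i (\<sigma> k) \<noteq> -\<infinity>" "\<lambda>i k. int (ordn i (\<sigma> k))"])
    fix i assume "i \<in> T"
    then show "a i (\<sigma> i) \<noteq> -\<infinity> \<and> int (ordn i (\<sigma> i)) = 0" using zero ordn0 by simp
  next
    fix \<pi> assume \<pi>: "\<pi> permutes T" and fe: "\<And>i. i \<in> T \<Longrightarrow> a i (\<sigma> (\<pi> i)) \<noteq> -\<infinity>"
    have "inj_on (\<sigma> \<circ> \<pi>) T" "(\<sigma> \<circ> \<pi>) ` T \<subseteq> \<sigma> ` T"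
      using \<pi> inj by (auto intro!: comp_inj_on simp: permutes_inj_on permutes_image permutes_in_image)
    then have "\<forall>i\<in>T. a i ((\<sigma> \<circ> \<pi>) i) = 0"
      using fe by (intro ballI no_positive_transversal_zero[OF npt]) (simp_all add: o_def)
    then show "(\<Sum>i\<in>T. int (ordn i (\<sigma> (\<pi> i)))) \<le> 0" using ordn0 by simp
  next
    fix l :: "nat \<Rightarrow> int"
    assume "\<And>i k. i \<in> T \<Longrightarrow> k \<in> T \<Longrightarrow> a i (\<sigma> k) \<noteq> -\<infinity> \<Longrightarrow> int (ordn i (\<sigma> k)) + l i \<le> l k"
    then show thesis by (rule that)
  qed
  \<comment> \<open>potentials are only determined up to a constant; this one makes them natural numbers\<close>
  define m where "m = (\<Sum>i\<in>T. \<bar>l i\<bar>)"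
  have m: "0 \<le> l i + m" if "i \<in> T" for i
    using member_le_sum[OF that, of "\<lambda>i. \<bar>l i\<bar>"] fin by (simp add: m_def)
  have "potential T \<sigma> (\<lambda>i. nat (l i + m))"
  proof (rule potentialI)
    fix i k assume *: "i \<in> T" "k \<in> T" "a i (\<sigma> k) \<noteq> -\<infinity>"
    with l[OF *] m[of i] m[of k] show "ordn i (\<sigma> k) + nat (l i + m) \<le> nat (l k + m)" by linarith
  qed
  then show thesis by (rule that)
qed

section \<open>The minimal canon\<close>

lemma bij_zero_transversal:
  assumes "finite Y" "card Y = card E" "finite E" "zero_transversal E Y \<sigma>"
  shows "bij_betw \<sigma> E Y"
  using assms unfolding zero_transversal_def bij_betw_def by (metis card_image card_subset_eq)

text \<open>The canons of \<open>Y\<close> are the potentials of any one zero transversal of \<open>Y\<close>. Therefore they are closed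
  under pointwise minima, and a canon is a potential for all zero transversals at once.\<close>

lemma canon_of_potential:
  assumes bij: "bij_betw \<sigma> {..<s} Y" and zero: "\<And>i. i < s \<Longrightarrow> a i (\<sigma> i) = 0"
    and pot: "potential {..<s} \<sigma> l"
  shows "canon a s Y l"
  unfolding canon_def
proof (intro exI conjI allI impI)
  fix i assume i: "i < s"
  show "a i (\<sigma> i) + ereal (real (l i)) =
      Max ((\<lambda>i'. a i' (\<sigma> i) + ereal (real (l i'))) ` {..<s})"
  proof (rule sym, rule Max_eqI)
    fix y assume "y \<in> (\<lambda>i'. a i' (\<sigma> i) + ereal (real (l i'))) ` {..<s}"
    with pot i zero[OF i] show "y \<le> a i (\<sigma> i) + ereal (real (l i))"
      by (auto simp: potential_def)
  qed (use i in auto)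
qed (rule bij)

text \<open>The bijection \<open>\<tau>\<close> of the canon need not be \<open>\<sigma>\<close>, but it is a zero transversal as well. Comparing the two
  on each column gives \<open>l (\<pi> i) \<le> l i\<close> for the permutation \<open>\<pi>\<close> that relates them; equality follows by
  summation.\<close>

lemma potential_of_canon:
  assumes bij: "bij_betw \<sigma> {..<s} Y" and zero: "\<And>i. i < s \<Longrightarrow> a i (\<sigma> i) = 0"
    and npt: "no_positive_transversal {..<s} Y" and can: "canon a s Y l"
  shows "potential {..<s} \<sigma> l"
proof -
  obtain \<tau> where bij': "bij_betw \<tau> {..<s} Y"
    and eq: "\<And>i. i < s \<Longrightarrow> a i (\<tau> i) + ereal (real (l i)) =
          Max ((\<lambda>i'. a i' (\<tau> i) + ereal (real (l i'))) ` {..<s})"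
    using can unfolding canon_def by blast
  have dominate: "a k (\<tau> i) + ereal (real (l k)) \<le> a i (\<tau> i) + ereal (real (l i))"
    if "i < s" "k < s" for i k
    unfolding eq[OF that(1)] by (rule Max_ge) (use that in auto)
  define \<pi> where "\<pi> i = the_inv_into {..<s} \<sigma> (\<tau> i)" for i
  have \<pi>: "\<pi> i < s" "\<sigma> (\<pi> i) = \<tau> i" if "i < s" for i
  proof -
    have "\<tau> i \<in> \<sigma> ` {..<s}" using that bij bij' by (auto simp: bij_betw_def)
    then show "\<pi> i < s" "\<sigma> (\<pi> i) = \<tau> i"
      using bij unfolding \<pi>_def bij_betw_def
      by (auto simp: f_the_inv_into_f dest: the_inv_into_into[OF _ _ subset_refl])
  qed
  have "a i (\<tau> i) \<noteq> -\<infinity>" if "i < s" for i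
  proof
    assume "a i (\<tau> i) = -\<infinity>"
    with dominate[OF that \<pi>(1)[OF that]] zero[OF \<pi>(1)[OF that]] \<pi>(2)[OF that]
    show False by simp
  qed
  then have zero': "a i (\<tau> i) = 0" if "i < s" for i
    using bij' that by (intro no_positive_transversal_zero[OF npt]) (auto simp: bij_betw_def)
  have le: "l (\<pi> i) \<le> l i" if "i < s" for i
    using dominate[OF that \<pi>(1)[OF that]] zero[OF \<pi>(1)[OF that]] \<pi>(2)[OF that] zero'[OF that]
    by simp
  have bij_\<pi>: "bij_betw \<pi> {..<s} {..<s}"
  proof -
    have "inj_on \<pi> {..<s}"
      using bij' \<pi>(2) by (metis bij_betw_def inj_on_def lessThan_iff)
    moreover have "\<pi> ` {..<s} \<subseteq> {..<s}" using \<pi>(1) by auto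
    ultimately show ?thesis by (simp add: bij_betw_def endo_inj_surj)
  qed
  have sums: "(\<Sum>i<s. l (\<pi> i)) = (\<Sum>i<s. l i)" by (rule sum.reindex_bij_betw[OF bij_\<pi>])
  have same: "l (\<pi> i) = l i" if "i < s" for i
  proof (rule ccontr)
    assume "l (\<pi> i) \<noteq> l i"
    with le[OF that] have "\<exists>i\<in>{..<s}. l (\<pi> i) < l i" using that by (intro bexI[of _ i]) auto
    then have "(\<Sum>i<s. l (\<pi> i)) < (\<Sum>i<s. l i)"
      using le by (intro sum_strict_mono_ex1) auto
    with sums show False by simp
  qed
  show ?thesis
    unfolding potential_def
  proof (intro ballI)
    fix i k assume ik: "i \<in> {..<s}" "k \<in> {..<s}"
    from ik(2) bij_\<pi> have "k \<in> \<pi> ` {..<s}" by (simp add: bij_betw_def)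
    then obtain m where m: "m < s" "\<pi> m = k" by auto
    with dominate[of m i] ik \<pi>(2)[of m] zero' same[of m]
    show "a i (\<sigma> k) + ereal (real (l i)) \<le> ereal (real (l k))" by simp
  qed
qed

text \<open>The pointwise minimum of all potentials is a potential, hence the least canon. This shows that
  \<open>min_canon\<close> is not a default value.\<close>

lemma min_canon_potential:
  assumes bij: "bij_betw \<sigma> {..<s} Y" and zero: "\<And>i. i < s \<Longrightarrow> a i (\<sigma> i) = 0"
    and npt: "no_positive_transversal {..<s} Y"
  shows "potential {..<s} \<sigma> (min_canon a s Y)"
proof -
  let ?S = "{l. potential {..<s} \<sigma> l}"
  have "zero_transversal {..<s} Y \<sigma>" "no_positive_transversal {..<s} (\<sigma> ` {..<s})"
    using bij zero npt by (auto simp: zero_transversal_def bij_betw_def)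
  from potential_exists[OF _ this] obtain l1 where l1: "l1 \<in> ?S" by auto
  define l0 where "l0 i = (LEAST m. \<exists>l\<in>?S. l i = m)" for i
  have attained: "\<exists>l\<in>?S. l i = l0 i" for i
    unfolding l0_def by (rule LeastI_ex) (use l1 in blast)
  have below: "l0 i \<le> l i" if "l \<in> ?S" for l i
    unfolding l0_def by (rule Least_le) (use that in blast)
  have pot: "potential {..<s} \<sigma> l0"
  proof (rule potentialI)
    fix i k assume ik: "i \<in> {..<s}" "k \<in> {..<s}" "a i (\<sigma> k) \<noteq> -\<infinity>"
    obtain l where l: "l \<in> ?S" "l k = l0 k" using attained by blast
    with potential_finite_entry[of _ \<sigma> l, OF _ ik] below[OF l(1), of i]
    show "ordn i (\<sigma> k) + l0 i \<le> l0 k" by simp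
  qed
  have "min_canon a s Y = l0"
    unfolding min_canon_def
  proof (rule Least_equality)
    show "canon a s Y l0" by (rule canon_of_potential[OF bij zero pot])
    fix l assume "canon a s Y l"
    from potential_of_canon[OF bij zero npt this] below show "l0 \<le> l" by (auto simp: le_fun_def)
  qed
  with pot show ?thesis by simp
qed

lemma beta_of_zero:
  assumes bij: "bij_betw \<sigma> {..<s} Y" and zero: "\<And>i. i < s \<Longrightarrow> a i (\<sigma> i) = 0"
    and npt: "no_positive_transversal {..<s} Y" and i: "i < s"
  shows "beta a s Y (\<sigma> i) = - alpha a s Y i"
proof -
  let ?l = "min_canon a s Y"
  have pot: "potential {..<s} \<sigma> ?l" by (rule min_canon_potential[OF bij zero npt])
  have le_Max: "?l k \<le> Max (?l ` {..<s})" if "k < s" for k using that by auto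
  show ?thesis
    unfolding beta_def
  proof (rule Max_eqI)
    fix y assume "y \<in> (\<lambda>k. a k (\<sigma> i) - alpha a s Y k) ` {..<s}"
    then obtain k where k: "k < s" "y = a k (\<sigma> i) - alpha a s Y k" by auto
    show "y \<le> - alpha a s Y i"
    proof (cases "a k (\<sigma> i) = -\<infinity>")
      case True
      then show ?thesis using k by (simp add: alpha_def)
    next
      case False
      from potential_finite_entry[OF pot _ _ this] k i le_Max[OF k(1)] le_Max[OF i]
      show ?thesis unfolding k(2) alpha_def finite_entry[OF False]
        by (simp add: of_nat_diff)
    qed
  next
    show "- alpha a s Y i \<in> (\<lambda>k. a k (\<sigma> i) - alpha a s Y k) ` {..<s}"
      using i zero[OF i] by (intro image_eqI[of _ _ i]) auto
  qed simp
qed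

text \<open>On every zero transversal \<open>\<beta>\<close> is \<open>- \<alpha>\<close>, so zeros are tight there. Conversely \<open>\<alpha>\<close> and \<open>\<beta>\<close> are finite on \<open>Y\<close>,
  so a tight transversal has finite entries and can only consist of zeros.\<close>

lemma tight_iff_zero:
  assumes fin: "finite Y" and J: "jacobi_number a Y {..<s} = 0" and card: "card Y = s"
    and bij: "bij_betw \<tau> {..<s} Y"
  shows "(\<forall>i<s. a i (\<tau> i) = alpha a s Y i + beta a s Y (\<tau> i)) \<longleftrightarrow> (\<forall>i<s. a i (\<tau> i) = 0)"
proof
  have npt: "no_positive_transversal {..<s} Y"
    using J fin by (simp add: jacobi_number_eq_0_iff)
  obtain \<sigma> where \<sigma>: "zero_transversal {..<s} Y \<sigma>"
    using J fin by (auto simp: jacobi_number_eq_0_iff)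
  have bij\<sigma>: "bij_betw \<sigma> {..<s} Y" using bij_zero_transversal[OF fin _ _ \<sigma>] card by simp
  have zero: "\<And>i. i < s \<Longrightarrow> a i (\<sigma> i) = 0" using \<sigma> by (simp add: zero_transversal_def)
  {
    assume tight: "\<forall>i<s. a i (\<tau> i) = alpha a s Y i + beta a s Y (\<tau> i)"
    have "a i (\<tau> i) \<noteq> -\<infinity>" if i: "i < s" for i
    proof -
      have "\<tau> i \<in> \<sigma> ` {..<s}" using i bij bij\<sigma> by (auto simp: bij_betw_def)
      then obtain k where k: "k < s" "\<tau> i = \<sigma> k" by auto
      show ?thesis using tight[rule_format, OF i] beta_of_zero[OF bij\<sigma> zero npt k(1)] k(2)
        by (simp add: alpha_def)
    qed
    then show "\<forall>i<s. a i (\<tau> i) = 0"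
      using bij by (intro allI impI no_positive_transversal_zero[OF npt]) (auto simp: bij_betw_def)
  next
    assume z: "\<forall>i<s. a i (\<tau> i) = 0"
    show "\<forall>i<s. a i (\<tau> i) = alpha a s Y i + beta a s Y (\<tau> i)"
    proof (intro allI impI)
      fix i assume i: "i < s"
      have "beta a s Y (\<tau> i) = - alpha a s Y i"
        using z by (intro beta_of_zero[OF bij _ npt i]) simp
      then show "a i (\<tau> i) = alpha a s Y i + beta a s Y (\<tau> i)" using z i by (simp add: alpha_def)
    qed
  }
qed

end


section \<open>Full row rank\<close>

text \<open>Linear independence of the rows in \<open>R\<close> of the matrix \<open>f\<close>, restricted to the columns in \<open>K\<close>.\<close>

definition left_independent :: "('a \<Rightarrow> 'b \<Rightarrow> real) \<Rightarrow> 'a set \<Rightarrow> 'b set \<Rightarrow> bool" where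
  "left_independent f R K \<longleftrightarrow>
     (\<forall>w. (\<forall>j\<in>K. (\<Sum>i\<in>R. w i * f i j) = 0) \<longrightarrow> (\<forall>i\<in>R. w i = 0))"

lemma left_independentD:
  "left_independent f R K \<Longrightarrow> (\<And>j. j \<in> K \<Longrightarrow> (\<Sum>i\<in>R. w i * f i j) = 0) \<Longrightarrow> i \<in> R \<Longrightarrow> w i = 0"
  unfolding left_independent_def by blast

lemma left_independent_cong:
  assumes "\<And>i j. i \<in> R \<Longrightarrow> j \<in> K \<Longrightarrow> f i j = g i j"
  shows "left_independent f R K \<longleftrightarrow> left_independent g R K"
proof -
  have "(\<Sum>i\<in>R. w i * f i j) = (\<Sum>i\<in>R. w i * g i j)" if "j \<in> K" for w j
    by (rule sum.cong) (use assms that in auto)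
  then show ?thesis unfolding left_independent_def by auto
qed

text \<open>Gaussian elimination: \<open>g\<close> is \<open>f\<close> after clearing column \<open>j\<close> with the pivot in row \<open>r\<close>.\<close>

lemma left_independent_square:
  fixes f :: "'a \<Rightarrow> 'b \<Rightarrow> real"
  assumes "finite R" "left_independent f R K"
  shows "\<exists>Y\<subseteq>K. finite Y \<and> card Y = card R \<and> left_independent f R Y"
  using assms
proof (induction R arbitrary: f K rule: finite_induct)
  case empty
  show ?case by (intro exI[of _ "{}"]) (simp add: left_independent_def)
next
  case (insert r R)
  have "\<exists>j\<in>K. f r j \<noteq> 0"
  proof (rule ccontr)
    assume "\<not> (\<exists>j\<in>K. f r j \<noteq> 0)"
    then have "(\<Sum>i\<in>insert r R. (if i = r then 1 else 0) * f i j) = 0" if "j \<in> K" for j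
      using that insert.hyps by (intro sum.neutral) auto
    from left_independentD[OF insert.prems this, of r] show False by simp
  qed
  then obtain j where j: "j \<in> K" "f r j \<noteq> 0" by blast
  define g where "g i k = f i k - f i j / f r j * f r k" for i k
  have extend: "(\<Sum>i\<in>insert r R. w i * f i k) = (\<Sum>i\<in>R. w i * g i k)"
    if "w r = - (\<Sum>i\<in>R. w i * f i j) / f r j" for w k
    using insert.hyps
    by (simp add: that g_def right_diff_distrib sum_subtractf sum_distrib_right sum_divide_distrib
        mult.assoc)
  have "left_independent g R (K - {j})"
    unfolding left_independent_def
  proof (intro allI impI ballI)
    fix u i assume u: "\<forall>k\<in>K - {j}. (\<Sum>i\<in>R. u i * g i k) = 0" and i: "i \<in> R"
    define w where "w = u(r := - (\<Sum>i\<in>R. u i * f i j) / f r j)"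
    have same: "(\<Sum>i\<in>R. w i * h i) = (\<Sum>i\<in>R. u i * h i)" for h
      using insert.hyps by (intro sum.cong) (auto simp: w_def)
    have wr: "w r = - (\<Sum>i\<in>R. w i * f i j) / f r j"
      unfolding same by (simp add: w_def)
    have "(\<Sum>i\<in>insert r R. w i * f i k) = 0" if "k \<in> K" for k
    proof (cases "k = j")
      case True
      then have "g i k = 0" for i using j by (simp add: g_def)
      then show ?thesis unfolding extend[OF wr] by simp
    next
      case False
      then show ?thesis unfolding extend[OF wr] same using u that by simp
    qed
    from left_independentD[OF insert.prems this, of i] i have "w i = 0" by simp
    moreover have "i \<noteq> r" using i insert.hyps by blast
    ultimately show "u i = 0" by (simp add: w_def)
  qed
  from insert.IH[OF this] obtain Y where
    Y: "Y \<subseteq> K - {j}" "finite Y" "card Y = card R" "left_independent g R Y" by blast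
  have "left_independent f (insert r R) (insert j Y)"
    unfolding left_independent_def
  proof (intro allI impI)
    fix w assume w: "\<forall>k\<in>insert j Y. (\<Sum>i\<in>insert r R. w i * f i k) = 0"
    have "w r * f r j = - (\<Sum>i\<in>R. w i * f i j)"
      using w insert.hyps by (simp add: eq_neg_iff_add_eq_0)
    then have wr: "w r = - (\<Sum>i\<in>R. w i * f i j) / f r j"
      by (subst nonzero_eq_divide_eq[OF j(2)])
    have "(\<Sum>i\<in>R. w i * g i k) = 0" if "k \<in> Y" for k
      using w extend[OF wr, of k] that by simp
    then have "\<forall>i\<in>R. w i = 0" using left_independentD[OF Y(4), of w] by blast
    moreover from this have "w r = 0" using wr by simp
    ultimately show "\<forall>i\<in>insert r R. w i = 0" by blast
  qed
  moreover have "card (insert j Y) = card (insert r R)"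
    using Y insert.hyps by (subst card_insert_disjoint) auto
  moreover have "insert j Y \<subseteq> K" using Y(1) j(1) by blast
  ultimately show ?case using Y(2) by (intro exI[of _ "insert j Y"]) simp
qed

lemma left_independent_reindex:
  assumes p: "bij_betw p A R" and q: "bij_betw q B K"
  shows "left_independent (\<lambda>i k. f (p i) (q k)) A B \<longleftrightarrow> left_independent f R K"
proof
  assume L: "left_independent (\<lambda>i k. f (p i) (q k)) A B"
  show "left_independent f R K"
    unfolding left_independent_def
  proof (intro allI impI ballI)
    fix w i assume w: "\<forall>j\<in>K. (\<Sum>i\<in>R. w i * f i j) = 0" and i: "i \<in> R"
    have "(\<Sum>i\<in>A. w (p i) * f (p i) (q k)) = 0" if "k \<in> B" for k
    proof -
      have "q k \<in> K" using q that by (auto simp: bij_betw_def)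
      with w sum.reindex_bij_betw[OF p, of "\<lambda>i. w i * f i (q k)"] show ?thesis by simp
    qed
    from left_independentD[OF L, of "\<lambda>i. w (p i)", OF this] have "\<And>i. i \<in> A \<Longrightarrow> w (p i) = 0" .
    then show "w i = 0" using i p by (auto simp: bij_betw_def)
  qed
next
  assume L: "left_independent f R K"
  show "left_independent (\<lambda>i k. f (p i) (q k)) A B"
    unfolding left_independent_def
  proof (intro allI impI ballI)
    fix w i assume w: "\<forall>k\<in>B. (\<Sum>i\<in>A. w i * f (p i) (q k)) = 0" and i: "i \<in> A"
    let ?u = "\<lambda>i. w (the_inv_into A p i)"
    have inv: "?u (p i) = w i" if "i \<in> A" for i
      using that p by (simp add: bij_betw_def the_inv_into_f_f)
    have "(\<Sum>i\<in>R. ?u i * f i j) = 0" if "j \<in> K" for j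
    proof -
      from q that obtain k where k: "k \<in> B" "q k = j" by (auto simp: bij_betw_def)
      have "(\<Sum>i\<in>R. ?u i * f i j) = (\<Sum>i\<in>A. ?u (p i) * f (p i) j)"
        by (rule sum.reindex_bij_betw[OF p, symmetric])
      also have "\<dots> = (\<Sum>i\<in>A. w i * f (p i) (q k))"
        by (rule sum.cong) (use inv k in auto)
      finally show ?thesis unfolding w[rule_format, OF k(1)] .
    qed
    from left_independentD[OF L, of ?u, OF this] have "?u (p i) = 0"
      using i p by (auto simp: bij_betw_def)
    with inv[OF i] show "w i = 0" by simp
  qed
qed

lemma bij_betw_pick:
  assumes "finite S"
  shows "bij_betw (pick S) {..<card S} S"
proof -
  have "inj_on (pick S) {..<card S}"
    by (rule inj_onI) (metis lessThan_iff linorder_neqE_nat pick_mono_le less_irrefl)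
  moreover have "pick S ` {..<card S} \<subseteq> S" using pick_in_set_le by auto
  ultimately show ?thesis
    using assms by (simp add: bij_betw_def card_image card_subset_eq)
qed

lemma pick_lessThan: "i < m \<Longrightarrow> pick {..<m} i = i"
  using pick_reduce_set[of i m UNIV] by (simp add: pick_UNIV lessThan_def)

lemma submatrix_mat:
  assumes "S \<subseteq> {..<nr}" "D \<subseteq> {..<nc}"
  shows "submatrix (mat nr nc (\<lambda>(i, j). f i j)) S D
    = mat (card S) (card D) (\<lambda>(i, j). f (pick S i) (pick D j))"
proof -
  have eq: "{i. i < nr \<and> i \<in> S} = S" "{j. j < nc \<and> j \<in> D} = D" using assms by auto
  have fin: "finite S" "finite D" using assms finite_subset by blast+
  have "pick S i < nr" if "i < card S" for i using pick_in_set_le[OF that] assms(1) by auto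
  moreover have "pick D j < nc" if "j < card D" for j using pick_in_set_le[OF that] assms(2) by auto
  ultimately show ?thesis unfolding submatrix_def by (auto simp: eq)
qed

lemma det_neq_0_iff_left_independent:
  fixes f :: "nat \<Rightarrow> nat \<Rightarrow> real"
  shows "det (mat m m (\<lambda>(i, j). f i j)) \<noteq> 0 \<longleftrightarrow> left_independent f {..<m} {..<m}"
proof -
  let ?A = "mat m m (\<lambda>(i, j). f i j)"
  have mult: "transpose_mat ?A *\<^sub>v v = vec m (\<lambda>j. \<Sum>i<m. v $ i * f i j)" if "v \<in> carrier_vec m" for v
    using that by (intro eq_vecI)
      (auto simp: scalar_prod_def lessThan_atLeast0 mult.commute intro!: sum.cong)
  have "det ?A = 0 \<longleftrightarrow> det (transpose_mat ?A) = 0"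
    by (subst det_transpose[of _ m]) auto
  also have "\<dots> \<longleftrightarrow> (\<exists>v. v \<in> carrier_vec m \<and> v \<noteq> 0\<^sub>v m \<and> transpose_mat ?A *\<^sub>v v = 0\<^sub>v m)"
    by (rule det_0_iff_vec_prod_zero_field) simp
  also have "\<dots> \<longleftrightarrow> \<not> left_independent f {..<m} {..<m}"
  proof
    assume "\<exists>v. v \<in> carrier_vec m \<and> v \<noteq> 0\<^sub>v m \<and> transpose_mat ?A *\<^sub>v v = 0\<^sub>v m"
    then obtain v where v: "v \<in> carrier_vec m" "v \<noteq> 0\<^sub>v m" "transpose_mat ?A *\<^sub>v v = 0\<^sub>v m" by blast
    have ker: "(\<Sum>i<m. v $ i * f i j) = 0" if "j < m" for j
    proof -
      have "vec m (\<lambda>j. \<Sum>i<m. v $ i * f i j) $ j = 0\<^sub>v m $ j" using v(3) mult[OF v(1)] by simp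
      then show ?thesis using that by simp
    qed
    show "\<not> left_independent f {..<m} {..<m}"
    proof
      assume L: "left_independent f {..<m} {..<m}"
      have "v = 0\<^sub>v m"
        using left_independentD[OF L, of "\<lambda>i. v $ i"] ker v(1) by (intro eq_vecI) auto
      with v(2) show False by contradiction
    qed
  next
    assume "\<not> left_independent f {..<m} {..<m}"
    then obtain w i where w: "\<forall>j<m. (\<Sum>i<m. w i * f i j) = 0" and i: "i < m" "w i \<noteq> 0"
      unfolding left_independent_def by auto
    let ?v = "vec m w"
    have "?v $ i \<noteq> 0\<^sub>v m $ i" using i by simp
    then have "?v \<noteq> 0\<^sub>v m" by metis
    moreover have "transpose_mat ?A *\<^sub>v ?v = 0\<^sub>v m"
    proof (rule eq_vecI)
      fix j assume "j < dim_vec (0\<^sub>v m)"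
      then show "(transpose_mat ?A *\<^sub>v ?v) $ j = 0\<^sub>v m $ j"
        using w by (subst mult) auto
    qed simp
    ultimately show "\<exists>v. v \<in> carrier_vec m \<and> v \<noteq> 0\<^sub>v m \<and> transpose_mat ?A *\<^sub>v v = 0\<^sub>v m"
      by (intro exI[of _ ?v]) simp
  qed
  finally show ?thesis by blast
qed

lemma det_submatrix_neq_0_iff:
  assumes "Y \<subseteq> {..<n}" "card Y = s"
  shows "det (submatrix (mat s n (\<lambda>(i, j). f i j)) {..<s} Y) \<noteq> (0 :: real) \<longleftrightarrow>
    left_independent f {..<s} Y"
proof -
  have "bij_betw (pick Y) {..<s} Y" "bij_betw (pick {..<s}) {..<s} {..<s}"
    using bij_betw_pick[of Y] bij_betw_pick[of "{..<s}"] assms finite_subset by auto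
  then show ?thesis
    unfolding submatrix_mat[OF subset_refl assms(1)] assms(2) card_lessThan
      det_neq_0_iff_left_independent
    by (intro left_independent_reindex)
qed

lemma (in vec_space) rank_le_n:
  assumes "A \<in> carrier_mat n nc"
  shows "rank A \<le> n"
proof -
  obtain S where S: "maximal S (\<lambda>T. T \<subseteq> set (cols A) \<and> lin_indpt T)"
    using maximal_exists_superset[of "set (cols A)" "\<lambda>T. T \<subseteq> set (cols A) \<and> lin_indpt T" "{}"]
    by (auto simp: finite_lin_indpt2)
  then have "S \<subseteq> set (cols A)" "lin_indpt S" by (auto simp: maximal_def)
  moreover from this have "S \<subseteq> carrier_vec n" using assms cols_dim by blast
  ultimately have "card S \<le> dim" by (intro li_le_dim(2)) auto
  then show ?thesis using rank_card_indpt[OF assms S] dim_is_n by simp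
qed

text \<open>If the rank is \<open>nr\<close>, a maximal independent set of columns forms a nonsingular square matrix, whose
  left kernel is trivial. Conversely, independent rows contain a nonsingular minor.\<close>

lemma mat_rank_eq_rows_iff:
  fixes f :: "nat \<Rightarrow> nat \<Rightarrow> real"
  shows "mat_rank (mat nr nc (\<lambda>(i, j). f i j)) = nr \<longleftrightarrow> left_independent f {..<nr} {..<nc}"
proof -
  interpret vec_space "TYPE(real)" nr .
  let ?A = "mat nr nc (\<lambda>(i, j). f i j)"
  have A: "?A \<in> carrier_mat nr nc" by simp
  have "rank ?A = nr \<longleftrightarrow> left_independent f {..<nr} {..<nc}"
  proof
    assume rank: "rank ?A = nr"
    obtain S where S: "maximal S (\<lambda>T. T \<subseteq> set (cols ?A) \<and> lin_indpt T)"
      using maximal_exists_superset[of "set (cols ?A)" "\<lambda>T. T \<subseteq> set (cols ?A) \<and> lin_indpt T" "{}"]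
      by (auto simp: finite_lin_indpt2)
    then have S_sub: "S \<subseteq> set (cols ?A)" and ind: "lin_indpt S" by (auto simp: maximal_def)
    have "finite S" using S_sub finite_subset by blast
    then obtain xs where xs: "set xs = S" "distinct xs" using finite_distinct_list by blast
    have len: "length xs = nr"
      using rank_card_indpt[OF A S] rank xs distinct_card[of xs] by simp
    have car: "set xs \<subseteq> carrier_vec nr" using S_sub xs(1) cols_dim[of ?A] by auto
    let ?h = "\<lambda>i k. xs ! k $ i"
    have B: "mat_of_cols nr xs = mat nr nr (\<lambda>(i, k). ?h i k)"
      using len by (intro eq_matI) (auto simp: mat_of_cols_index)
    have "rank (mat_of_cols nr xs) = nr"
      using xs ind car len by (intro lin_indpt_full_rank) (auto intro!: carrier_matI)
    then have "det (mat_of_cols nr xs) \<noteq> 0"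
      by (subst det_rank_iff) (auto simp: len intro!: carrier_matI)
    then have L: "left_independent ?h {..<nr} {..<nr}"
      unfolding B det_neq_0_iff_left_independent .
    show "left_independent f {..<nr} {..<nc}"
      unfolding left_independent_def
    proof (intro allI impI ballI)
      fix w i assume w: "\<forall>j\<in>{..<nc}. (\<Sum>i<nr. w i * f i j) = 0" and i: "i \<in> {..<nr}"
      have "(\<Sum>i<nr. w i * ?h i k) = 0" if "k \<in> {..<nr}" for k
      proof -
        have "xs ! k \<in> set (cols ?A)" using that len xs(1) S_sub nth_mem[of k xs] by auto
        then obtain j where j: "j < nc" "xs ! k = col ?A j"
          by (auto simp: in_set_conv_nth)
        have "(\<Sum>i<nr. w i * ?h i k) = (\<Sum>i<nr. w i * f i j)"
          by (rule sum.cong) (use j in auto)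
        with w j(1) show ?thesis by simp
      qed
      from left_independentD[OF L this i] show "w i = 0" .
    qed
  next
    assume "left_independent f {..<nr} {..<nc}"
    from left_independent_square[OF _ this] obtain Y where
      Y: "Y \<subseteq> {..<nc}" "card Y = nr" "left_independent f {..<nr} Y" by auto
    then have "det (submatrix ?A {..<nr} Y) \<noteq> 0" by (simp add: det_submatrix_neq_0_iff)
    from rank_gt_minor[OF A this] have "card {j. j < nc \<and> j \<in> Y} \<le> rank ?A" .
    moreover have "{j. j < nc \<and> j \<in> Y} = Y" using Y(1) by auto
    ultimately show "rank ?A = nr" using Y(2) rank_le_n[OF A] by simp
  qed
  then show ?thesis by (simp add: mat_rank_def)
qed

lemma mat_rank_submatrix_iff:
  fixes f :: "nat \<Rightarrow> nat \<Rightarrow> real"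
  assumes "S \<subseteq> {..<s}" "D \<subseteq> {..<n}"
  shows "mat_rank (submatrix (mat s n (\<lambda>(i, j). f i j)) S D) = card S \<longleftrightarrow> left_independent f S D"
proof -
  have fin: "finite S" "finite D" using assms finite_subset by blast+
  show ?thesis
    unfolding submatrix_mat[OF assms] mat_rank_eq_rows_iff
    by (rule left_independent_reindex[OF bij_betw_pick[OF fin(1)] bij_betw_pick[OF fin(2)]])
qed

section \<open>Determinants as sums over transversals\<close>

lemma det_submatrix_expand:
  assumes Y: "Y \<subseteq> {..<n}" "card Y = s"
  shows "det (submatrix (mat s n (\<lambda>(i, j). f i j)) {..<s} Y) =
    (\<Sum>p | p permutes {0..<s}. signof p * (\<Prod>i<s. f i (pick Y (p i)) :: real))"
proof -
  have "det (submatrix (mat s n (\<lambda>(i, j). f i j)) {..<s} Y) =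
      (\<Sum>p | p permutes {0..<s}. signof p * (\<Prod>i = 0..<s.
        mat s s (\<lambda>(i, j). f (pick {..<s} i) (pick Y j)) $$ (i, p i)))"
    unfolding submatrix_mat[OF subset_refl Y(1)] Y(2) card_lessThan
    by (rule det_def') simp
  also have "\<dots> = (\<Sum>p | p permutes {0..<s}. signof p * (\<Prod>i<s. f i (pick Y (p i))))"
  proof (rule sum.cong[OF refl])
    fix p assume "p \<in> {p. p permutes {0..<s}}"
    then have p: "p i < s" if "i < s" for i using that permutes_in_image[of p "{0..<s}" i] by simp
    have "(\<Prod>i = 0..<s. mat s s (\<lambda>(i, j). f (pick {..<s} i) (pick Y j)) $$ (i, p i)) =
        (\<Prod>i<s. f i (pick Y (p i)))"
      unfolding lessThan_atLeast0 by (rule prod.cong) (auto simp: p pick_lessThan lessThan_atLeast0[symmetric])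
    then show "signof p * (\<Prod>i = 0..<s. mat s s (\<lambda>(i, j). f (pick {..<s} i) (pick Y j)) $$ (i, p i)) =
        signof p * (\<Prod>i<s. f i (pick Y (p i)))" by simp
  qed
  finally show ?thesis .
qed

lemma bij_betw_pick_permutation:
  assumes Y: "Y \<subseteq> {..<n}" "card Y = s" and p: "p permutes {0..<s}"
  shows "bij_betw (\<lambda>i. pick Y (p i)) {..<s} Y"
proof -
  have "bij_betw (pick Y) {..<s} Y" using bij_betw_pick[of Y] Y finite_subset by auto
  moreover have "bij_betw p {..<s} {..<s}"
    using permutes_imp_bij[OF p] by (simp add: lessThan_atLeast0)
  ultimately show ?thesis using bij_betw_trans by (fastforce simp: o_def)
qed

text \<open>Two matrices with the same nonvanishing products along transversals have the same determinant,
  even if they differ in many entries.\<close>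

lemma det_submatrix_cong_transversals:
  fixes f g :: "nat \<Rightarrow> nat \<Rightarrow> real"
  assumes Y: "Y \<subseteq> {..<n}" "card Y = s"
    and agree: "\<And>\<tau>. bij_betw \<tau> {..<s} Y \<Longrightarrow> (\<forall>i<s. f i (\<tau> i) = g i (\<tau> i)) \<or>
      (\<exists>i<s. f i (\<tau> i) = 0) \<and> (\<exists>i<s. g i (\<tau> i) = 0)"
  shows "det (submatrix (mat s n (\<lambda>(i, j). f i j)) {..<s} Y) =
    det (submatrix (mat s n (\<lambda>(i, j). g i j)) {..<s} Y)"
  unfolding det_submatrix_expand[OF Y]
proof (rule sum.cong[OF refl])
  fix p assume "p \<in> {p. p permutes {0..<s}}"
  then have "bij_betw (\<lambda>i. pick Y (p i)) {..<s} Y"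
    using bij_betw_pick_permutation[OF Y] by blast
  from agree[OF this] have "(\<Prod>i<s. f i (pick Y (p i))) = (\<Prod>i<s. g i (pick Y (p i)))"
  proof
    assume "\<forall>i<s. f i (pick Y (p i)) = g i (pick Y (p i))"
    then show ?thesis by (intro prod.cong) auto
  next
    assume "(\<exists>i<s. f i (pick Y (p i)) = 0) \<and> (\<exists>i<s. g i (pick Y (p i)) = 0)"
    then have "(\<Prod>i<s. f i (pick Y (p i))) = 0" "(\<Prod>i<s. g i (pick Y (p i))) = 0"
      by (auto intro!: prod_zero)
    then show ?thesis by (simp only:)
  qed
  then show "signof p * (\<Prod>i<s. f i (pick Y (p i))) = signof p * (\<Prod>i<s. g i (pick Y (p i)))"
    by simp
qed

lemma det_submatrix_neq_0_transversal:
  fixes f :: "nat \<Rightarrow> nat \<Rightarrow> real"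
  assumes Y: "Y \<subseteq> {..<n}" "card Y = s"
    and nz: "det (submatrix (mat s n (\<lambda>(i, j). f i j)) {..<s} Y) \<noteq> 0"
  obtains \<tau> where "bij_betw \<tau> {..<s} Y" "\<And>i. i < s \<Longrightarrow> f i (\<tau> i) \<noteq> 0"
proof -
  obtain p where p: "p permutes {0..<s}" "signof p * (\<Prod>i<s. f i (pick Y (p i))) \<noteq> 0"
    using nz unfolding det_submatrix_expand[OF Y] by (metis (no_types, lifting) mem_Collect_eq sum.neutral)
  then have "f i (pick Y (p i)) \<noteq> 0" if "i < s" for i using that by auto
  with bij_betw_pick_permutation[OF Y p(1)] show thesis by (rule that)
qed


context nat_order_matrix
begin

section \<open>The blocks produced by the test\<close>

text \<open>The columns of the matrix \<open>B\<close> of the test, when the rows \<open>R\<close> are left.\<close>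

definition pure_columns :: "nat \<Rightarrow> nat set \<Rightarrow> nat set" where
  "pure_columns n R =
     {j. j < n \<and> (\<exists>i\<in>R. a i j \<noteq> -\<infinity>) \<and> (\<forall>i\<in>R. a i j = 0 \<or> a i j = -\<infinity>)}"

lemma finite_pure_columns: "finite (pure_columns n R)"
  by (rule finite_subset[of _ "{..<n}"]) (auto simp: pure_columns_def)

lemma potential_subset: "potential T \<sigma> l \<Longrightarrow> T' \<subseteq> T \<Longrightarrow> potential T' \<sigma> l"
  unfolding potential_def by blast

text \<open>Minimality of \<open>l i\<close> leaves no room in the inequality \<open>ordn k (\<sigma> i) + l k \<le> l i\<close>.\<close>

lemma tight_columns:
  assumes pot: "potential R \<sigma> l" and zero: "a i (\<sigma> i) = 0" and i: "i \<in> R"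
    and min: "\<And>k. k \<in> R \<Longrightarrow> l i \<le> l k" and k: "k \<in> R" and fin: "a k (\<sigma> i) \<noteq> -\<infinity>"
  shows "a k (\<sigma> i) = 0" "l k = l i"
proof -
  have "ordn k (\<sigma> i) + l k \<le> l i" by (rule potential_finite_entry[OF pot k i fin])
  with min[OF k] have "ordn k (\<sigma> i) = 0" "l k = l i" by linarith+
  then show "a k (\<sigma> i) = 0" "l k = l i" using finite_entry[OF fin] by simp_all
qed

text \<open>Let \<open>I\<close> be the set of rows with minimal potential. The zeros in the columns \<open>\<sigma> ` I\<close> lie in rows of \<open>I\<close>,
  so moving \<open>I\<close> into the rows of the canonical cover makes these columns superfluous. The exchange
  does not enlarge the cover, since \<open>\<sigma>\<close> maps each new row to a column that is dropped.\<close>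

lemma minimal_rows_in_canonical_cover:
  assumes fin: "finite R" and \<sigma>: "zero_transversal R Y \<sigma>" and Y: "Y \<subseteq> {..<n}"
    and pot: "potential R \<sigma> l" and can: "is_canonical a R (pure_columns n R) (R0, C0)"
    and i: "i \<in> R" and min: "\<And>k. k \<in> R \<Longrightarrow> l i \<le> l k"
  shows "i \<in> R0"
proof -
  let ?E = "\<lambda>i j. a i j = 0" and ?B = "pure_columns n R"
  define I where "I = {i\<in>R. \<forall>k\<in>R. l i \<le> l k}"
  note finB = finite_pure_columns[of n R]
  have inj: "inj_on \<sigma> R" and zero: "\<And>i. i \<in> R \<Longrightarrow> a i (\<sigma> i) = 0" and img: "\<sigma> ` R \<subseteq> Y"
    using \<sigma> by (auto simp: zero_transversal_def)
  have I_sub: "I \<subseteq> R" by (auto simp: I_def)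
  have col: "a k (\<sigma> i) = 0 \<and> k \<in> I" if "i \<in> I" "k \<in> R" "a k (\<sigma> i) \<noteq> -\<infinity>" for i k
    using tight_columns[OF pot zero, of i k] that by (auto simp: I_def)
  have pure: "\<sigma> i \<in> ?B" if "i \<in> I" for i
  proof -
    have "i \<in> R" using that I_sub by blast
    moreover have "\<sigma> i < n" using \<open>i \<in> R\<close> img Y by auto
    moreover have "\<forall>k\<in>R. a k (\<sigma> i) = 0 \<or> a k (\<sigma> i) = -\<infinity>" using col[OF that] by blast
    moreover have "a i (\<sigma> i) \<noteq> -\<infinity>" using zero[OF \<open>i \<in> R\<close>] by simp
    ultimately show ?thesis unfolding pure_columns_def by blast
  qed
  have m: "min_cover a R ?B (R0, C0)" using can by (simp add: is_canonical_def)
  then have C: "covers ?E R ?B R0 C0" and size: "card R0 + card C0 = max_diag_zeros a R ?B"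
    by (simp_all add: min_cover_iff)
  note fin0 = covers_finite[OF C fin finB]
  have C': "covers ?E R ?B (R0 \<union> I) (C0 - \<sigma> ` I)"
    unfolding covers_def
  proof (intro conjI ballI impI)
    show "R0 \<union> I \<subseteq> R" "C0 - \<sigma> ` I \<subseteq> ?B" using C I_sub by (auto simp: covers_def)
    fix k j assume kj: "k \<in> R" "j \<in> ?B" "a k j = 0"
    then have "k \<in> R0 \<or> j \<in> C0" using C unfolding covers_def by blast
    moreover have "k \<in> I" if "j \<in> \<sigma> ` I" using that col kj by auto
    ultimately show "k \<in> R0 \<union> I \<or> j \<in> C0 - \<sigma> ` I" by blast
  qed
  have finI: "finite I" using I_sub fin finite_subset by blast
  have "card (I - R0) \<le> card (C0 \<inter> \<sigma> ` I)"
  proof (rule card_inj_on_le)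
    show "inj_on \<sigma> (I - R0)" using inj I_sub by (auto intro: inj_on_subset)
    show "\<sigma> ` (I - R0) \<subseteq> C0 \<inter> \<sigma> ` I"
    proof
      fix j assume "j \<in> \<sigma> ` (I - R0)"
      then obtain k where k: "k \<in> I" "k \<notin> R0" "j = \<sigma> k" by blast
      then have "k \<in> R" using I_sub by blast
      then have "k \<in> R0 \<or> \<sigma> k \<in> C0"
        using C zero pure[OF k(1)] unfolding covers_def by blast
      with k show "j \<in> C0 \<inter> \<sigma> ` I" by blast
    qed
  qed (use fin0 in simp)
  moreover have "card (R0 \<union> I) = card R0 + card (I - R0)"
    using card_Un_disjoint[of R0 "I - R0"] fin0 finI by (simp add: Un_Diff_cancel)
  moreover have "card (C0 - \<sigma> ` I) = card C0 - card (C0 \<inter> \<sigma> ` I)"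
    using fin0 by (simp add: card_Diff_subset_Int)
  moreover have "card (C0 \<inter> \<sigma> ` I) \<le> card C0"
    using fin0 by (intro card_mono) auto
  moreover have "max_diag_zeros a R ?B \<le> card (R0 \<union> I) + card (C0 - \<sigma> ` I)"
    by (rule max_diag_zeros_le_cover[OF fin finB C'])
  ultimately have "card (R0 \<union> I) + card (C0 - \<sigma> ` I) = max_diag_zeros a R ?B"
    using size by linarith
  with C' have "min_cover a R ?B (R0 \<union> I, C0 - \<sigma> ` I)" by (simp add: min_cover_iff)
  with can have "R0 \<union> I \<subseteq> R0" unfolding is_canonical_def by fastforce
  moreover have "i \<in> I" using i min by (simp add: I_def)
  ultimately show ?thesis by blast
qed

text \<open>Such a column could be dropped from the cover, contradicting minimality.\<close>

lemma column_outside_canonical_cover: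
  assumes fin: "finite R" and can: "is_canonical a R (pure_columns n R) (R0, C0)"
    and zeros: "\<And>i. i \<in> R \<Longrightarrow> a i j = 0 \<Longrightarrow> i \<in> R0"
  shows "j \<notin> C0"
proof
  assume j: "j \<in> C0"
  let ?B = "pure_columns n R"
  note finB = finite_pure_columns[of n R]
  have C: "covers (\<lambda>i j. a i j = 0) R ?B R0 C0"
    and size: "card R0 + card C0 = max_diag_zeros a R ?B"
    using can by (simp_all add: is_canonical_def min_cover_iff)
  have "covers (\<lambda>i j. a i j = 0) R ?B R0 (C0 - {j})"
    using C zeros unfolding covers_def by blast
  from max_diag_zeros_le_cover[OF fin finB this] size covers_finite[OF C fin finB] j
  show False using card_Diff1_less[of C0 j] by linarith
qed

text \<open>The successive steps of a run of the test that does not fail. The set of columns kept by the test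
  does not occur, since it contains all columns that are not \<open>-\<infinity>\<close> in the remaining rows.\<close>

fun peeling :: "nat \<Rightarrow> nat set \<Rightarrow> (nat set \<times> nat set) list \<Rightarrow> bool" where
  "peeling n R [] \<longleftrightarrow> R = {}"
| "peeling n R ((R0, D) # L) \<longleftrightarrow> R0 \<noteq> {} \<and>
     (\<exists>C0. is_canonical a R (pure_columns n R) (R0, C0) \<and> D = pure_columns n R - C0) \<and>
     peeling n (R - R0) L"

text \<open>A zero transversal and a potential restrict to the remaining rows. So in each step the columns
  suffice, each row has a zero, and a row of minimal potential shows that \<open>R\<^sub>0\<close> is not empty.\<close>

lemma obar_test_peeling:
  assumes "finite R" "zero_transversal R {..<n} \<sigma>" "potential R \<sigma> l" "K \<subseteq> {..<n}"
    and "\<And>i j. i \<in> R \<Longrightarrow> j < n \<Longrightarrow> a i j \<noteq> -\<infinity> \<Longrightarrow> j \<in> K"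
  shows "\<exists>L. obar_test a R K = Some L \<and> peeling n R L"
  using assms
proof (induction "card R" arbitrary: R K rule: less_induct)
  case less
  note fin = less.prems(1) and \<sigma> = less.prems(2) and pot = less.prems(3)
    and K = less.prems(4) and live = less.prems(5)
  show ?case
  proof (cases "R = {}")
    case True
    then show ?thesis by (subst obar_test.simps) simp
  next
    case False
    have inj: "inj_on \<sigma> R" and zero: "\<And>i. i \<in> R \<Longrightarrow> a i (\<sigma> i) = 0" and img: "\<sigma> ` R \<subseteq> {..<n}"
      using \<sigma> by (auto simp: zero_transversal_def)
    have finK: "finite K" using K finite_subset by blast
    have in_K: "\<sigma> i \<in> K" if "i \<in> R" for i
      using live[OF that, of "\<sigma> i"] zero[OF that] img that by auto
    then have "card R \<le> card K"
      using inj finK by (intro card_inj_on_le[of \<sigma>]) auto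
    moreover have "\<not> (\<exists>i\<in>R. \<forall>j\<in>K. a i j \<noteq> 0)" using in_K zero by blast
    ultimately have no_fail: "\<not> (card R > card K \<or> (\<exists>i\<in>R. \<forall>j\<in>K. a i j \<noteq> 0))" by simp
    define K' where "K' = {j\<in>K. \<exists>i\<in>R. a i j \<noteq> -\<infinity>}"
    have B: "{j\<in>K'. \<forall>i\<in>R. a i j = 0 \<or> a i j = -\<infinity>} = pure_columns n R"
      using live K unfolding K'_def pure_columns_def by auto
    obtain R0 C0 where cc: "canonical_cover a R (pure_columns n R) = (R0, C0)" by force
    have can: "is_canonical a R (pure_columns n R) (R0, C0)"
      using is_canonical_canonical_cover[OF fin finite_pure_columns] cc by metis
    then have R0_sub: "R0 \<subseteq> R" by (simp add: is_canonical_def min_cover_def)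
    have "R0 \<noteq> {}"
    proof -
      obtain i where "i \<in> R" "\<forall>k\<in>R. l i \<le> l k"
        using ex_has_least_nat[of "\<lambda>i. i \<in> R" _ l] False by blast
      then show ?thesis
        using minimal_rows_in_canonical_cover[OF fin \<sigma> subset_refl pot can] by blast
    qed
    have "card (R - R0) < card R"
      using fin R0_sub \<open>R0 \<noteq> {}\<close> by (intro psubset_card_mono) auto
    moreover have "zero_transversal (R - R0) {..<n} \<sigma>"
      using \<sigma> by (auto simp: zero_transversal_def inj_on_def)
    moreover have "j \<in> K'" if "i \<in> R - R0" "j < n" "a i j \<noteq> -\<infinity>" for i j
      using that live[of i j] by (auto simp: K'_def)
    moreover have "K' \<subseteq> {..<n}" using K by (auto simp: K'_def)
    ultimately obtain L where L: "obar_test a (R - R0) K' = Some L" "peeling n (R - R0) L"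
      using less.hyps[of "R - R0" K'] fin potential_subset[OF pot, of "R - R0"] by auto
    have "obar_test a R K = Some ((R0, pure_columns n R - C0) # L)"
      using False no_fail \<open>R0 \<noteq> {}\<close> L(1)
      by (subst obar_test.simps) (simp add: Let_def B cc K'_def[symmetric])
    moreover have "peeling n R ((R0, pure_columns n R - C0) # L)"
      using \<open>R0 \<noteq> {}\<close> can L(2) by auto
    ultimately show ?thesis by blast
  qed
qed

text \<open>A zero in a column of the first block must be covered by a row, as the covering columns were removed;
  hence the rows of later steps have only \<open>-\<infinity>\<close> there.\<close>

lemma peeling_head:
  assumes "peeling n R ((R0, D) # L)"
  shows "R0 \<subseteq> R" "D \<subseteq> {..<n}" "peeling n (R - R0) L"
    and "\<And>i j. i \<in> R \<Longrightarrow> j \<in> D \<Longrightarrow> a i j = 0 \<or> a i j = -\<infinity>"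
    and "\<And>i j. i \<in> R - R0 \<Longrightarrow> j \<in> D \<Longrightarrow> a i j = -\<infinity>"
proof -
  obtain C0 where can: "is_canonical a R (pure_columns n R) (R0, C0)"
    and D: "D = pure_columns n R - C0" using assms by auto
  have C: "covers (\<lambda>i j. a i j = 0) R (pure_columns n R) R0 C0"
    using can by (simp add: is_canonical_def min_cover_iff)
  show "R0 \<subseteq> R" using C by (simp add: covers_def)
  show "D \<subseteq> {..<n}" using D by (auto simp: pure_columns_def)
  show "peeling n (R - R0) L" using assms by simp
  show entry: "a i j = 0 \<or> a i j = -\<infinity>" if "i \<in> R" "j \<in> D" for i j
    using that D by (auto simp: pure_columns_def)
  show "a i j = -\<infinity>" if "i \<in> R - R0" "j \<in> D" for i j
    using entry[of i j] that C D unfolding covers_def by blast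
qed

lemma peeling_rows: "peeling n R L \<Longrightarrow> R = \<Union> (fst ` set L)"
proof (induction L arbitrary: R)
  case (Cons x L)
  obtain R0 D where x: "x = (R0, D)" by force
  note h = peeling_head[OF Cons.prems[unfolded x]]
  have "R - R0 = \<Union> (fst ` set L)" by (rule Cons.IH[OF h(3)])
  then show ?case using h(1) x by auto
qed simp

lemma peeling_drop: "peeling n R L \<Longrightarrow> peeling n (\<Union> (fst ` set (drop k L))) (drop k L)"
proof (induction L arbitrary: R k)
  case (Cons x L)
  show ?case
  proof (cases k)
    case 0
    then show ?thesis using Cons.prems peeling_rows[OF Cons.prems] by simp
  next
    case (Suc m)
    obtain R0 D where "x = (R0, D)" by force
    with Cons.prems have "peeling n (R - R0) L" by simp
    from Cons.IH[OF this, of m] show ?thesis using Suc by simp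
  qed
qed simp

lemma peeling_block_mem:
  assumes "peeling n R L" "(R0, D) \<in> set L" "i \<in> R0"
  shows "i \<in> R" "j \<in> D \<Longrightarrow> a i j = 0 \<or> a i j = -\<infinity>"
proof -
  have "i \<in> R \<and> (\<forall>j\<in>D. a i j = 0 \<or> a i j = -\<infinity>)"
    using assms
  proof (induction L arbitrary: R)
    case (Cons x L)
    obtain R1 D1 where x: "x = (R1, D1)" by force
    note h = peeling_head[OF Cons.prems(1)[unfolded x]]
    show ?case
    proof (cases "(R0, D) \<in> set L")
      case True
      with Cons.IH[OF h(3)] Cons.prems(3) show ?thesis by blast
    next
      case False
      then have "R0 = R1" "D = D1" using Cons.prems(2) x by auto
      with h(1,4) Cons.prems(3) show ?thesis by blast
    qed
  qed simp
  then show "i \<in> R" "j \<in> D \<Longrightarrow> a i j = 0 \<or> a i j = -\<infinity>" by blast+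
qed

definition in_block :: "(nat set \<times> nat set) list \<Rightarrow> nat \<Rightarrow> nat \<Rightarrow> bool" where
  "in_block L i j \<longleftrightarrow> (\<exists>(R0, D)\<in>set L. i \<in> R0 \<and> j \<in> D)"

lemma in_block_Cons:
  "in_block ((R0, D) # L) i j \<longleftrightarrow> i \<in> R0 \<and> j \<in> D \<or> in_block L i j"
  by (auto simp: in_block_def)

text \<open>If one finite transversal stays in the blocks, then so do all others in the same columns. Indeed
  the later rows cannot use the columns of the first block, so they fill all the columns that \<open>\<sigma>\<close> gives
  them, and the rows of the first block are left with the columns of the first block.\<close>

lemma transversal_in_blocks:
  assumes "peeling n R L" "finite R" "inj_on \<sigma> R" "inj_on \<tau> R" "\<tau> ` R \<subseteq> \<sigma> ` R"
    and "\<And>i. i \<in> R \<Longrightarrow> a i (\<sigma> i) \<noteq> -\<infinity>" "\<And>i. i \<in> R \<Longrightarrow> a i (\<tau> i) \<noteq> -\<infinity>"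
    and "\<And>i. i \<in> R \<Longrightarrow> in_block L i (\<sigma> i)" "i \<in> R"
  shows "in_block L i (\<tau> i)"
  using assms
proof (induction L arbitrary: R i)
  case (Cons x L)
  obtain R0 D where x: "x = (R0, D)" by force
  note h = peeling_head[OF Cons.prems(1)[unfolded x]]
  note fin = Cons.prems(2) and inj = Cons.prems(3,4) and sub = Cons.prems(5)
    and fe = Cons.prems(6,7) and blk = Cons.prems(8)
  have tail: "in_block L k (\<sigma> k)" if "k \<in> R - R0" for k
    using blk[of k] that x by (simp add: in_block_Cons)
  have head: "\<sigma> k \<in> D" if k: "k \<in> R0" for k
  proof -
    have "\<not> in_block L k (\<sigma> k)"
      using peeling_block_mem(1)[OF h(3)] k by (auto simp: in_block_def)
    then show ?thesis using blk[of k] k h(1) x by (auto simp: in_block_Cons)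
  qed
  have out: "\<sigma> k \<notin> D" "\<tau> k \<notin> D" if "k \<in> R - R0" for k
    using h(5)[OF that] fe that by blast+
  have "\<tau> ` (R - R0) \<subseteq> \<sigma> ` (R - R0)"
  proof
    fix j assume "j \<in> \<tau> ` (R - R0)"
    then obtain k where k: "k \<in> R - R0" "j = \<tau> k" by blast
    then obtain m where "m \<in> R" "j = \<sigma> m" using sub by blast
    moreover have "m \<notin> R0" using head[of m] out(2)[OF k(1)] k(2) \<open>j = \<sigma> m\<close> by metis
    ultimately show "j \<in> \<sigma> ` (R - R0)" by blast
  qed
  have inj': "inj_on \<sigma> (R - R0)" "inj_on \<tau> (R - R0)"
    using inj by (auto intro: inj_on_subset)
  have eq: "\<tau> ` (R - R0) = \<sigma> ` (R - R0)"
    using \<open>\<tau> ` (R - R0) \<subseteq> \<sigma> ` (R - R0)\<close> inj' fin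
    by (intro card_subset_eq) (auto simp: card_image)
  show ?case
  proof (cases "i \<in> R0")
    case True
    have "\<tau> i \<notin> \<tau> ` (R - R0)"
      using True Cons.prems(9) inj(2) by (auto simp: inj_on_def)
    moreover obtain m where m: "m \<in> R" "\<tau> i = \<sigma> m" using sub Cons.prems(9) by blast
    ultimately have "m \<in> R0" unfolding eq by auto
    then have "\<tau> i \<in> D" using head m(2) by simp
    then show ?thesis using True x by (simp add: in_block_Cons)
  next
    case False
    have "in_block L i (\<tau> i)"
      using False Cons.prems(9) fe fin tail
      by (intro Cons.IH[OF h(3) _ inj' \<open>\<tau> ` (R - R0) \<subseteq> \<sigma> ` (R - R0)\<close>]) auto
    then show ?thesis using x by (simp add: in_block_Cons)
  qed
qed simp

text \<open>A left kernel vector vanishes on the rows of the first block because the later rows vanish in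
  its columns; then the same argument applies to the next block. The relation \<open>Q\<close> is a parameter so that
  the induction can keep it fixed while the list gets shorter.\<close>

lemma left_independent_of_blocks:
  assumes "peeling n R L" "finite R"
    and "\<And>R0 D. (R0, D) \<in> set L \<Longrightarrow> left_independent g R0 D"
    and "\<And>R0 D i j. (R0, D) \<in> set L \<Longrightarrow> i \<in> R0 \<Longrightarrow> j \<in> D \<Longrightarrow> Q i j"
    and g: "\<And>i j. a i j = -\<infinity> \<Longrightarrow> g i j = 0"
  shows "left_independent (\<lambda>i j. if Q i j then g i j else 0) R {..<n}"
  using assms(1-4)
proof (induction L arbitrary: R)
  case Nil
  then show ?case by (simp add: left_independent_def)
next
  case (Cons x L)
  obtain R0 D where x: "x = (R0, D)" by force
  note h = peeling_head[OF Cons.prems(1)[unfolded x]]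
  let ?g = "\<lambda>i j. if Q i j then g i j else 0"
  have split: "(\<Sum>i\<in>R. w i * ?g i j) = (\<Sum>i\<in>R0. w i * ?g i j) + (\<Sum>i\<in>R - R0. w i * ?g i j)"
    for w j
    using sum.subset_diff[OF h(1) Cons.prems(2), of "\<lambda>i. w i * ?g i j"] by (simp add: add.commute)
  have tail: "left_independent ?g (R - R0) {..<n}"
  proof (rule Cons.IH[OF h(3)])
    show "finite (R - R0)" using Cons.prems(2) by simp
    show "left_independent g R1 D1" if "(R1, D1) \<in> set L" for R1 D1
      using Cons.prems(3)[of R1 D1] that by simp
    show "Q i j" if "(R1, D1) \<in> set L" "i \<in> R1" "j \<in> D1" for R1 D1 i j
      using Cons.prems(4)[of R1 D1 i j] that by simp
  qed
  show ?case
    unfolding left_independent_def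
  proof (intro allI impI)
    fix w assume w: "\<forall>j\<in>{..<n}. (\<Sum>i\<in>R. w i * ?g i j) = 0"
    have zero_head: "w i = 0" if "i \<in> R0" for i
    proof (rule left_independentD[OF Cons.prems(3)[of R0 D] _ that])
      fix j assume j: "j \<in> D"
      have "(\<Sum>i\<in>R - R0. w i * ?g i j) = 0"
        using h(5)[OF _ j] g by (intro sum.neutral) auto
      moreover have "(\<Sum>i\<in>R. w i * ?g i j) = 0" using w h(2) j by blast
      ultimately have "(\<Sum>i\<in>R0. w i * ?g i j) = 0" unfolding split by simp
      moreover have "(\<Sum>i\<in>R0. w i * ?g i j) = (\<Sum>i\<in>R0. w i * g i j)"
        using Cons.prems(4)[of R0 D _ j] j x by (intro sum.cong) auto
      ultimately show "(\<Sum>i\<in>R0. w i * g i j) = 0" by simp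
    qed (simp add: x)
    have "(\<Sum>i\<in>R - R0. w i * ?g i j) = 0" if "j \<in> {..<n}" for j
    proof -
      have "(\<Sum>i\<in>R0. w i * ?g i j) = 0" using zero_head by (intro sum.neutral) auto
      moreover have "(\<Sum>i\<in>R. w i * ?g i j) = 0" using w that by blast
      ultimately show ?thesis unfolding split by simp
    qed
    from left_independentD[OF tail, of w, OF this] zero_head show "\<forall>i\<in>R. w i = 0" by blast
  qed
qed

section \<open>Dense block triangular order matrices\<close>

lemma block_triangular_parts:
  assumes bt: "block_triangular s n a p Sig Xi" and h: "h \<in> {1..p}"
  shows "disjoint_family_on Sig {1..p}" "(\<Union>h\<in>{1..p}. Sig h) = {..<s}" "Sig h \<noteq> {}"
    "(\<Union>h\<in>{0..p}. Xi h) = {..<n}" "card (Xi (h - 1)) = card (Sig h)"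
    "jacobi_number a (Xi (h - 1)) (Sig h) = ereal (real (card (Xi (h - 1))))"
    "jacobi_number a (Xi h) (Sig h) = 0"
    and "\<And>i j k. i \<in> Sig h \<Longrightarrow> k \<in> {0..p} \<Longrightarrow> j \<in> Xi k \<Longrightarrow> h < k \<Longrightarrow> a i j = -\<infinity>"
    and "\<And>i. i \<in> Sig h \<Longrightarrow> (SUP j\<in>Xi (h - 1). a i j) = 1"
proof -
  note all = bt[unfolded block_triangular_def]
  note rest = all[THEN conjunct2, THEN conjunct2, THEN conjunct2]
  note block = bspec[OF rest[THEN conjunct2, THEN conjunct2] h]
  note orders = bspec[OF block[THEN conjunct1]]
  show "disjoint_family_on Sig {1..p}" by (rule all[THEN conjunct1])
  show "(\<Union>h\<in>{1..p}. Sig h) = {..<s}" by (rule all[THEN conjunct2, THEN conjunct1])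
  show "Sig h \<noteq> {}"
    by (rule bspec[OF all[THEN conjunct2, THEN conjunct2, THEN conjunct1] h])
  show "(\<Union>h\<in>{0..p}. Xi h) = {..<n}" by (rule rest[THEN conjunct2, THEN conjunct1])
  show "card (Xi (h - 1)) = card (Sig h)" by (rule block[THEN conjunct2, THEN conjunct1])
  show "jacobi_number a (Xi (h - 1)) (Sig h) = ereal (real (card (Xi (h - 1))))"
    by (rule block[THEN conjunct2, THEN conjunct2, THEN conjunct1])
  show "jacobi_number a (Xi h) (Sig h) = 0"
    by (rule block[THEN conjunct2, THEN conjunct2, THEN conjunct2])
  show "a i j = -\<infinity>" if "i \<in> Sig h" "k \<in> {0..p}" "j \<in> Xi k" "h < k" for i j k
    using bspec[OF bspec[OF orders[OF that(1), THEN conjunct1] that(2)] that(3)] that(4) by simp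
  show "(SUP j\<in>Xi (h - 1). a i j) = 1" if "i \<in> Sig h" for i
    by (rule orders[OF that, THEN conjunct2])
qed

text \<open>The orders in \<open>Xi (h - 1)\<close> are at most \<open>1\<close>, so the Jacobi number of \<open>Xi (h - 1)\<close> is attained by a bijection
  along which all orders are \<open>1\<close>. Hence each column of \<open>Xi (h - 1)\<close> has an entry \<open>1\<close>.\<close>

lemma block_triangularD:
  assumes bt: "block_triangular s n a p Sig Xi" and h: "h \<in> {1..p}"
  shows "Sig h \<noteq> {}" "Sig h \<subseteq> {..<s}" "Xi h \<subseteq> {..<n}" "card (Sig h) \<le> card (Xi h)"
    and "\<And>i j k. i \<in> Sig h \<Longrightarrow> k \<in> {0..p} \<Longrightarrow> j \<in> Xi k \<Longrightarrow> h < k \<Longrightarrow> a i j = -\<infinity>"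
    and "\<And>j. j \<in> Xi (h - 1) \<Longrightarrow> \<exists>i\<in>Sig h. a i j = 1"
proof -
  note parts = block_triangular_parts[OF bt h]
  show "Sig h \<noteq> {}" by (rule parts(3))
  show S: "Sig h \<subseteq> {..<s}" unfolding parts(2)[symmetric] using h by (rule UN_upper)
  have "h \<in> {0..p}" "h - 1 \<in> {0..p}" using h by auto
  then show Xh: "Xi h \<subseteq> {..<n}" unfolding parts(4)[symmetric] by (intro UN_upper)
  have Xh1: "Xi (h - 1) \<subseteq> {..<n}"
    unfolding parts(4)[symmetric] using \<open>h - 1 \<in> {0..p}\<close> by (rule UN_upper)
  have fin: "finite (Sig h)" "finite (Xi h)" "finite (Xi (h - 1))"
    using S Xh Xh1 finite_subset by blast+
  note c = parts(5) and J1 = parts(6) and J0 = parts(7) and sup = parts(9)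
  obtain \<sigma> where "zero_transversal (Sig h) (Xi h) \<sigma>"
    using J0 fin by (auto simp: jacobi_number_eq_0_iff)
  then show "card (Sig h) \<le> card (Xi h)"
    using fin by (intro card_inj_on_le[of \<sigma>]) (auto simp: zero_transversal_def)
  show "a i j = -\<infinity>" if "i \<in> Sig h" "k \<in> {0..p}" "j \<in> Xi k" "h < k" for i j k
    by (rule parts(8)[OF that])
  show "\<exists>i\<in>Sig h. a i j = 1" if j: "j \<in> Xi (h - 1)" for j
  proof -
    have "jacobi_number a (Xi (h - 1)) (Sig h) \<noteq> -\<infinity>" using J1 by simp
    from jacobi_number_attained[OF fin(1,3) this] obtain \<rho> where
      \<rho>: "inj_on \<rho> (Sig h)" "\<rho> ` Sig h \<subseteq> Xi (h - 1)"
      "(\<Sum>i\<in>Sig h. a i (\<rho> i)) = ereal (real (card (Sig h)))" using J1 c by metis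
    have fe: "\<forall>i\<in>Sig h. a i (\<rho> i) \<noteq> -\<infinity>"
    proof (rule ccontr)
      assume "\<not> (\<forall>i\<in>Sig h. a i (\<rho> i) \<noteq> -\<infinity>)"
      then have "(\<Sum>i\<in>Sig h. a i (\<rho> i)) = -\<infinity>"
        unfolding sum_entries[OF fin(1)] by (rule if_not_P)
      with \<rho>(3) show False by simp
    qed
    have "(\<Sum>i\<in>Sig h. a i (\<rho> i)) = ereal (real (\<Sum>i\<in>Sig h. ordn i (\<rho> i)))"
      unfolding sum_entries[OF fin(1)] using fe by (rule if_P)
    with \<rho>(3) have total: "(\<Sum>i\<in>Sig h. ordn i (\<rho> i)) = card (Sig h)"
      by (metis ereal.inject of_nat_eq_iff)
    have le1: "ordn i (\<rho> i) \<le> 1" if i: "i \<in> Sig h" for i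
    proof -
      have "a i (\<rho> i) \<le> (SUP j\<in>Xi (h - 1). a i j)"
        using \<rho>(2) i by (intro SUP_upper) auto
      then have "ereal (real (ordn i (\<rho> i))) \<le> ereal 1"
        using sup[OF i] finite_entry[of i "\<rho> i"] fe i by (metis one_ereal_def)
      then show ?thesis by simp
    qed
    have "j \<in> \<rho> ` Sig h"
    proof -
      have "\<rho> ` Sig h = Xi (h - 1)"
        using \<rho>(1,2) c fin by (intro card_subset_eq) (auto simp: card_image)
      then show ?thesis using j by simp
    qed
    then obtain i where i: "i \<in> Sig h" "j = \<rho> i" by blast
    have "ordn i (\<rho> i) = 1"
    proof (rule ccontr)
      assume "ordn i (\<rho> i) \<noteq> 1"
      with le1[OF i(1)] have "\<exists>i\<in>Sig h. ordn i (\<rho> i) < 1" using i(1) by (intro bexI[of _ i]) auto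
      then have "(\<Sum>i\<in>Sig h. ordn i (\<rho> i)) < (\<Sum>i\<in>Sig h. 1)"
        using le1 fin by (intro sum_strict_mono_ex1) auto
      with total show False by simp
    qed
    then have "a i (\<rho> i) = 1" using finite_entry[of i "\<rho> i"] fe i(1) by (simp add: one_ereal_def)
    with i show ?thesis by blast
  qed
qed

lemma block_triangular_block_eq:
  assumes bt: "block_triangular s n a p Sig Xi"
    and "h \<in> {1..p}" "k \<in> {1..p}" "i \<in> Sig h" "i \<in> Sig k"
  shows "h = k"
  using block_triangular_parts(1)[OF bt assms(2)] assms(2-) unfolding disjoint_family_on_def by blast

text \<open>Columns of \<open>Xi k\<close> with \<open>k < q\<close> have an entry \<open>1\<close> in \<open>Sig (k + 1)\<close>; those with \<open>k > q\<close> contain only \<open>-\<infinity>\<close>.\<close>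

lemma dense_pure_columns:
  assumes bt: "block_triangular s n a p Sig Xi"
    and dense: "\<forall>h\<in>{1..p}. \<forall>i\<in>Sig h. \<forall>j\<in>Xi h. a i j = 0"
    and q: "q \<in> {1..p}"
  shows "pure_columns n (\<Union>h\<in>{1..q}. Sig h) = Xi q" (is "pure_columns n ?R = _")
proof (intro equalityI subsetI)
  fix j assume j: "j \<in> pure_columns n ?R"
  then have "j \<in> (\<Union>h\<in>{0..p}. Xi h)"
    unfolding block_triangular_parts(4)[OF bt q] pure_columns_def by simp
  then obtain k where k: "k \<in> {0..p}" "j \<in> Xi k" by blast
  have "\<not> k < q"
  proof
    assume "k < q"
    then have "Suc k \<in> {1..p}" "Suc k \<in> {1..q}" using q by auto
    then obtain i where "i \<in> Sig (Suc k)" "a i j = 1"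
      using block_triangularD(6)[OF bt, of "Suc k" j] k(2) by auto
    with j \<open>Suc k \<in> {1..q}\<close> have "(1::ereal) = 0 \<or> (1::ereal) = -\<infinity>"
      unfolding pure_columns_def by force
    then show False by simp
  qed
  moreover have "\<not> q < k"
  proof
    assume "q < k"
    have "a i j = -\<infinity>" if "i \<in> ?R" for i
    proof -
      from that obtain h where h: "h \<in> {1..q}" "i \<in> Sig h" by blast
      then have "h \<in> {1..p}" "h < k" using q \<open>q < k\<close> by auto
      then show ?thesis using block_triangularD(5)[OF bt _ h(2) k] by blast
    qed
    with j show False unfolding pure_columns_def by blast
  qed
  ultimately show "j \<in> Xi q" using k(2) by simp
next
  fix j assume j: "j \<in> Xi q"
  have "a i j = 0 \<or> a i j = -\<infinity>" if "i \<in> ?R" for i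
  proof -
    from that obtain h where h: "h \<in> {1..q}" "i \<in> Sig h" by blast
    show ?thesis
    proof (cases "h = q")
      case True
      then show ?thesis using dense[rule_format, OF q] h j by blast
    next
      case False
      then have "h \<in> {1..p}" "h < q" "q \<in> {0..p}" using h q by auto
      then show ?thesis using block_triangularD(5)[OF bt _ h(2) _ j] by blast
    qed
  qed
  moreover obtain i where i: "i \<in> Sig q" using block_triangularD(1)[OF bt q] by blast
  moreover have "i \<in> ?R" using i q by auto
  moreover have "a i j \<noteq> -\<infinity>" using dense[rule_format, OF q i j] by simp
  moreover have "j < n" using block_triangularD(3)[OF bt q] j by auto
  ultimately show "j \<in> pure_columns n ?R" unfolding pure_columns_def by blast
qed

text \<open>All zeros lie in \<open>Sig q \<times> Xi q\<close>, which is full of zeros, so a cover contains \<open>Sig q\<close> or all of \<open>Xi q\<close>. As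
  \<open>#Sig q \<le> #Xi q\<close>, the rows \<open>Sig q\<close> form a minimum cover, and it has the most rows.\<close>

lemma dense_is_canonical:
  assumes bt: "block_triangular s n a p Sig Xi"
    and dense: "\<forall>h\<in>{1..p}. \<forall>i\<in>Sig h. \<forall>j\<in>Xi h. a i j = 0"
    and q: "q \<in> {1..p}"
  shows "is_canonical a (\<Union>h\<in>{1..q}. Sig h) (Xi q) (Sig q, {})" (is "is_canonical a ?R _ _")
proof -
  let ?E = "\<lambda>i j. a i j = 0"
  have Rs: "?R \<subseteq> {..<s}" using block_triangularD(2)[OF bt] q by fastforce
  have fin: "finite ?R" "finite (Xi q)" "finite (Sig q)"
    using Rs block_triangularD(2,3)[OF bt q] finite_subset by blast+
  have C: "covers ?E ?R (Xi q) (Sig q) {}"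
    unfolding covers_def
  proof (intro conjI ballI impI)
    show "Sig q \<subseteq> ?R" using q by auto
    fix i j assume ij: "i \<in> ?R" "j \<in> Xi q" "a i j = 0"
    then obtain h where h: "h \<in> {1..q}" "i \<in> Sig h" by blast
    have "h = q"
    proof (rule ccontr)
      assume "h \<noteq> q"
      then have "h \<in> {1..p}" "h < q" "q \<in> {0..p}" using h q by auto
      then have "a i j = -\<infinity>" using block_triangularD(5)[OF bt _ h(2) _ ij(2)] by blast
      with ij(3) show False by simp
    qed
    then show "i \<in> Sig q \<or> j \<in> {}" using h by simp
  qed simp
  have large: "Sig q \<subseteq> R' \<or> Xi q \<subseteq> C'" if "covers ?E ?R (Xi q) R' C'" for R' C'
    using that bspec[OF dense q] q unfolding covers_def by fastforce
  have bound: "card (Sig q) \<le> card R' + card C'" if C': "covers ?E ?R (Xi q) R' C'" for R' C'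
  proof -
    note f = covers_finite[OF C' fin(1,2)]
    from large[OF C'] show ?thesis
    proof
      assume "Sig q \<subseteq> R'"
      from card_mono[OF f(1) this] show ?thesis by simp
    next
      assume "Xi q \<subseteq> C'"
      from card_mono[OF f(2) this] block_triangularD(4)[OF bt q] show ?thesis by simp
    qed
  qed
  obtain D A B where D: "matching ?E ?R (Xi q) D" and AB: "covers ?E ?R (Xi q) A B"
    "card D = card A + card B"
    by (rule koenig[OF fin(1,2), of ?E])
  have "max_diag_zeros a ?R (Xi q) = card (Sig q)"
    using max_diag_zeros_eq[OF fin(1,2) D AB] bound[OF AB(1)] AB(2)
      max_diag_zeros_le_cover[OF fin(1,2) C] by simp
  then have "min_cover a ?R (Xi q) (Sig q, {})" using C by (simp add: min_cover_iff)
  moreover have "R' \<subseteq> Sig q" if m: "min_cover a ?R (Xi q) (R', C')" for R' C'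
  proof -
    have C': "covers ?E ?R (Xi q) R' C'" and size: "card R' + card C' = card (Sig q)"
      using m \<open>max_diag_zeros a ?R (Xi q) = card (Sig q)\<close> by (simp_all add: min_cover_iff)
    note f = covers_finite[OF C' fin(1,2)]
    from large[OF C'] show ?thesis
    proof
      assume "Sig q \<subseteq> R'"
      moreover have "card R' \<le> card (Sig q)" using size by simp
      ultimately show ?thesis using card_seteq[OF f(1)] by blast
    next
      assume "Xi q \<subseteq> C'"
      from card_mono[OF f(2) this] block_triangularD(4)[OF bt q] size have "card R' = 0" by linarith
      then show ?thesis using f(1) by simp
    qed
  qed
  ultimately show ?thesis unfolding is_canonical_def by auto
qed

text \<open>Each step of the test removes the last of the given blocks, since the canonical cover is unique.\<close>

lemma dense_peeling:
  assumes bt: "block_triangular s n a p Sig Xi"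
    and dense: "\<forall>h\<in>{1..p}. \<forall>i\<in>Sig h. \<forall>j\<in>Xi h. a i j = 0"
    and "q \<le> p" "peeling n (\<Union>h\<in>{1..q}. Sig h) L"
  shows "L = map (\<lambda>h. (Sig h, Xi h)) (rev [1..<Suc q])"
  using assms(3,4)
proof (induction q arbitrary: L)
  case 0
  then have "\<Union> (fst ` set L) = {}" using peeling_rows[OF 0(2)] by simp
  then show ?case
  proof (cases L)
    case (Cons x L')
    obtain R0 D where "x = (R0, D)" by force
    then show ?thesis using 0(2) Cons \<open>\<Union> (fst ` set L) = {}\<close> by simp
  qed simp
next
  case (Suc q)
  let ?R = "\<Union>h\<in>{1..Suc q}. Sig h"
  have q: "Suc q \<in> {1..p}" using Suc.prems by simp
  have "Sig (Suc q) \<subseteq> ?R" by (rule UN_upper) simp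
  then have "?R \<noteq> {}" using block_triangularD(1)[OF bt q] by blast
  then have "L \<noteq> []" using Suc.prems(2) by auto
  then obtain R0 D L' where L: "L = (R0, D) # L'" by (metis list.exhaust prod.exhaust)
  obtain C0 where can: "is_canonical a ?R (pure_columns n ?R) (R0, C0)"
    and D: "D = pure_columns n ?R - C0" and rest: "peeling n (?R - R0) L'"
    using Suc.prems(2) unfolding L peeling.simps by blast
  note pure = dense_pure_columns[OF bt dense q]
  have "(R0, C0) = (Sig (Suc q), {})"
    using is_canonical_unique[OF can[unfolded pure] dense_is_canonical[OF bt dense q]] .
  then have eq: "R0 = Sig (Suc q)" "D = Xi (Suc q)" using D pure by simp_all
  have "?R - Sig (Suc q) = (\<Union>h\<in>{1..q}. Sig h)"
  proof -
    have "Sig h \<inter> Sig (Suc q) = {}" if "h \<in> {1..q}" for h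
      using block_triangular_block_eq[OF bt _ q, of h] that Suc.prems(1) by fastforce
    moreover have "{1..Suc q} = insert (Suc q) {1..q}" by auto
    then have "?R = Sig (Suc q) \<union> (\<Union>h\<in>{1..q}. Sig h)" by (simp only: UN_insert)
    ultimately show ?thesis by blast
  qed
  with rest eq have "peeling n (\<Union>h\<in>{1..q}. Sig h) L'" by simp
  from Suc.IH[OF _ this] Suc.prems(1) have "L' = map (\<lambda>h. (Sig h, Xi h)) (rev [1..<Suc q])" by simp
  then show ?case using L eq by simp
qed

text \<open>Let \<open>b\<close> have minimal potential among the rows outside their block, say \<open>b \<in> Sig h\<close> and \<open>\<tau> b \<in> Xi k\<close> with
  \<open>k < h\<close>. An entry \<open>1\<close> in column \<open>\<tau> b\<close> belongs to a row of \<open>Sig (k + 1)\<close> of smaller potential. By the choice of \<open>b\<close>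
  this row stays in its block, so its column has an entry \<open>1\<close> in \<open>Sig (k + 2)\<close>, and so on up to \<open>Sig h\<close>. The
  row \<open>i \<in> Sig h\<close> found there has smaller potential than \<open>b\<close>, but by density \<open>a b (\<tau> i) = 0\<close>, which
  gives \<open>l b \<le> l i\<close>.\<close>

lemma dense_transversal_in_blocks:
  assumes bt: "block_triangular s n a p Sig Xi"
    and dense: "\<forall>h\<in>{1..p}. \<forall>i\<in>Sig h. \<forall>j\<in>Xi h. a i j = 0"
    and \<tau>: "zero_transversal {..<s} {..<n} \<tau>" and pot: "potential {..<s} \<tau> l"
    and h: "h \<in> {1..p}" and i: "i \<in> Sig h"
  shows "\<tau> i \<in> Xi h"
proof (rule ccontr)
  define bad where "bad i \<longleftrightarrow> (\<exists>h\<in>{1..p}. i \<in> Sig h \<and> \<tau> i \<notin> Xi h)" for i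
  assume "\<tau> i \<notin> Xi h"
  then have "bad i" using h i by (auto simp: bad_def)
  from ex_has_least_nat[of bad, OF this, of l] obtain b where
    b: "bad b" and least: "\<And>k. bad k \<Longrightarrow> l b \<le> l k" by blast
  then obtain h where h: "h \<in> {1..p}" "b \<in> Sig h" "\<tau> b \<notin> Xi h" by (auto simp: bad_def)
  have zero: "\<And>i. i < s \<Longrightarrow> a i (\<tau> i) = 0" and img: "\<tau> ` {..<s} \<subseteq> {..<n}"
    using \<tau> by (auto simp: zero_transversal_def)
  have rows: "i < s" if "h \<in> {1..p}" "i \<in> Sig h" for h i
    using block_triangularD(2)[OF bt that(1)] that(2) by auto
  have bs: "b < s" using rows h by blast
  then have "\<tau> b \<in> (\<Union>h\<in>{0..p}. Xi h)"
    unfolding block_triangular_parts(4)[OF bt h(1)] using img by auto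
  then obtain k where k: "k \<in> {0..p}" "\<tau> b \<in> Xi k" by blast
  have "\<not> h < k" using block_triangularD(5)[OF bt h(1,2) k] zero[OF bs] by auto
  moreover have "k \<noteq> h" using k h by auto
  ultimately have "Suc k \<le> h" by simp
  have drop: "\<exists>i'\<in>Sig (Suc m). l i' < l i" if i: "i < s" "\<tau> i \<in> Xi m" and m: "Suc m \<in> {1..p}" for i m
  proof -
    obtain i' where i': "i' \<in> Sig (Suc m)" "a i' (\<tau> i) = 1"
      using block_triangularD(6)[OF bt m] i(2) by auto
    have "a i' (\<tau> i) \<noteq> -\<infinity>" using i' by simp
    from potential_finite_entry[OF pot _ _ this] finite_entry[OF this] i' rows[OF m i'(1)] i(1)
    have "l i' < l i" by (simp add: one_ereal_def)
    with i' show ?thesis by blast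
  qed
  have climb: "\<exists>i\<in>Sig m. l i < l b" if "Suc k \<le> m" "m \<le> h" for m
    using that
  proof (induction m rule: dec_induct)
    case base
    then have "Suc k \<in> {1..p}" using h by auto
    from drop[OF bs k(2) this] show ?case .
  next
    case (step m)
    then obtain i where i: "i \<in> Sig m" "l i < l b" by auto
    have m: "m \<in> {1..p}" "Suc m \<in> {1..p}" using step h by auto
    have "\<not> bad i" using least[of i] i(2) by auto
    then have "\<tau> i \<in> Xi m" using m(1) i(1) by (auto simp: bad_def)
    from drop[OF rows[OF m(1) i(1)] this m(2)] i(2) show ?case using less_trans by blast
  qed
  from climb[OF \<open>Suc k \<le> h\<close>] obtain i where i: "i \<in> Sig h" "l i < l b" by auto
  have "\<not> bad i" using least[of i] i(2) by auto
  then have "\<tau> i \<in> Xi h" using h(1) i(1) by (auto simp: bad_def)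
  then have "a b (\<tau> i) = 0" using dense[rule_format, OF h(1,2)] by blast
  then have "a b (\<tau> i) \<noteq> -\<infinity>" by simp
  from potential_finite_entry[OF pot _ _ this] bs rows[OF h(1) i(1)] have "l b \<le> l i" by simp
  with i(2) show False by simp
qed

end


section \<open>The determinant of an optimal square subsystem\<close>

lemma nat_order_matrix_order_matrix: "nat_order_matrix (order_matrix U P)"
  by unfold_locales (auto simp: order_matrix_def jet_ord_def)

definition jac :: "(nat \<Rightarrow> jet \<Rightarrow> real) \<Rightarrow> jet \<Rightarrow> nat \<Rightarrow> nat \<Rightarrow> real" where
  "jac P z i j = pd (Der j 0) (P i) z"

definition zero_part :: "jet set \<Rightarrow> (nat \<Rightarrow> jet \<Rightarrow> real) \<Rightarrow> jet \<Rightarrow> nat \<Rightarrow> nat \<Rightarrow> real" where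
  "zero_part U P z i j = (if order_matrix U P i j = 0 then jac P z i j else 0)"

lemma jac_eq_0:
  assumes z: "z \<in> U" and a: "order_matrix U P i j = -\<infinity>"
  shows "jac P z i j = 0"
proof -
  have "\<not> depends_on U (P i) (Der j 0)"
    using a by (auto simp: order_matrix_def jet_ord_def split: if_splits)
  then have "\<forall>\<^sub>F v in nhds (z (Der j 0)). P i (z(Der j 0 := v)) = P i z"
    using z unfolding depends_on_def by blast
  then have "deriv (\<lambda>v. P i (z(Der j 0 := v))) (z (Der j 0)) = deriv (\<lambda>v. P i z) (z (Der j 0))"
    by (rule deriv_cong_ev) simp
  then show ?thesis by (simp add: jac_def pd_def)
qed

lemma zero_part_eq_jac:
  assumes "z \<in> U" "order_matrix U P i j = 0 \<or> order_matrix U P i j = -\<infinity>"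
  shows "zero_part U P z i j = jac P z i j"
  using assms jac_eq_0[OF assms(1)] by (auto simp: zero_part_def)

lemma top_order_eq_0: "order_matrix U P i j = 0 \<Longrightarrow> top_order U j (P i) = 0"
  by (auto simp: order_matrix_def jet_ord_def zero_ereal_def split: if_splits)

text \<open>Both matrices have the same products along zero transversals, and along all other bijections at
  least one factor vanishes, by \<open>tight_iff_zero\<close>.\<close>

lemma nabla_eq_det_zero_part:
  assumes Y: "Y \<subseteq> {..<n}" "card Y = s" and J: "jacobi_number (order_matrix U P) Y {..<s} = 0"
  shows "nabla s n U P Y z = det (submatrix (mat s n (\<lambda>(i, j). zero_part U P z i j)) {..<s} Y)"
proof -
  interpret nat_order_matrix "order_matrix U P" by (rule nat_order_matrix_order_matrix)
  have fin: "finite Y" using Y(1) finite_subset by blast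
  show ?thesis
    unfolding nabla_def Let_def
  proof (rule det_submatrix_cong_transversals[OF Y])
    fix \<tau> assume "bij_betw \<tau> {..<s} Y"
    note tight = tight_iff_zero[OF fin J Y(2) this]
    show "(\<forall>i<s. (if order_matrix U P i (\<tau> i)
            = alpha (order_matrix U P) s Y i + beta (order_matrix U P) s Y (\<tau> i)
          then pd (Der (\<tau> i) (top_order U (\<tau> i) (P i))) (P i) z else 0)
        = zero_part U P z i (\<tau> i)) \<or>
      (\<exists>i<s. (if order_matrix U P i (\<tau> i)
            = alpha (order_matrix U P) s Y i + beta (order_matrix U P) s Y (\<tau> i)
          then pd (Der (\<tau> i) (top_order U (\<tau> i) (P i))) (P i) z else 0) = 0) \<and>
      (\<exists>i<s. zero_part U P z i (\<tau> i) = 0)"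
    proof (cases "\<forall>i<s. order_matrix U P i (\<tau> i) = 0")
      case True
      with tight have "\<forall>i<s. order_matrix U P i (\<tau> i)
        = alpha (order_matrix U P) s Y i + beta (order_matrix U P) s Y (\<tau> i)" by blast
      with True show ?thesis by (simp add: zero_part_def jac_def top_order_eq_0)
    next
      case False
      then obtain i where "i < s" "order_matrix U P i (\<tau> i) \<noteq> 0" by blast
      then have "\<exists>i<s. zero_part U P z i (\<tau> i) = 0" by (auto simp: zero_part_def)
      moreover from False tight obtain k where "k < s" "order_matrix U P k (\<tau> k)
        \<noteq> alpha (order_matrix U P) s Y k + beta (order_matrix U P) s Y (\<tau> k)" by blast
      ultimately show ?thesis by (intro disjI2 conjI) (auto intro!: exI[of _ k])
    qed
  qed
qed

lemma obar_system_optimal: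
  assumes "obar_system s n U P"
  obtains Y where "Y \<subseteq> {..<n}" "card Y = s" "jacobi_number (order_matrix U P) Y {..<s} = 0"
proof -
  let ?J = "\<lambda>Y. jacobi_number (order_matrix U P) Y {..<s}"
  let ?S = "{Y. Y \<subseteq> {..<n} \<and> card Y = s \<and> ?J Y \<noteq> -\<infinity>}"
  have Inf: "Inf (?J ` ?S) = 0" using assms by (simp add: obar_system_def obar_number_def)
  have "finite ?S" by (rule finite_subset[of _ "Pow {..<n}"]) auto
  then have fin: "finite (?J ` ?S)" by (rule finite_imageI)
  have ne: "?J ` ?S \<noteq> {}"
  proof
    assume "?J ` ?S = {}"
    with Inf show False by (simp add: top_ereal_def)
  qed
  have "0 \<in> ?J ` ?S" using Min_in[OF fin ne] unfolding Min_Inf[OF fin ne] Inf .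
  then show thesis
  proof (rule imageE)
    fix Y assume "0 = ?J Y" "Y \<in> ?S"
    then show thesis by (intro that[of Y]) simp_all
  qed
qed

section \<open>From full row ranks to regularity\<close>

text \<open>The columns \<open>Y\<close> are chosen for the matrix \<open>?M\<close> of the diagonal blocks, not for the whole matrix: this makes
  a nonzero product in its determinant a zero transversal inside the blocks, which forces the Jacobi number
  of \<open>Y\<close> to be \<open>0\<close>.\<close>

lemma obar_regular_of_blocks:
  assumes peel: "nat_order_matrix.peeling (order_matrix U P) n {..<s} L" and z: "z \<in> U"
    and ind: "\<And>R0 D. (R0, D) \<in> set L \<Longrightarrow> left_independent (jac P z) R0 D"
  shows "obar_regular s n U P z"
proof -
  let ?a = "order_matrix U P" and ?g = "zero_part U P z"
  interpret nat_order_matrix ?a by (rule nat_order_matrix_order_matrix)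
  let ?M = "\<lambda>i j. if in_block L i j then ?g i j else 0"
  have g0: "?g i j = 0" if "?a i j = -\<infinity>" for i j using that by (simp add: zero_part_def)
  have "left_independent ?M {..<s} {..<n}"
  proof (rule left_independent_of_blocks[OF peel _ _ _ g0])
    fix R0 D assume RD: "(R0, D) \<in> set L"
    have eq: "?g i j = jac P z i j" if "i \<in> R0" "j \<in> D" for i j
      using zero_part_eq_jac[OF z peeling_block_mem(2)[OF peel RD that]] .
    show "left_independent ?g R0 D"
      using ind[OF RD] eq by (simp only: left_independent_cong[of R0 D ?g "jac P z"])
    show "in_block L i j" if "i \<in> R0" "j \<in> D" for i j
      using RD that by (auto simp: in_block_def)
  qed simp
  from left_independent_square[OF _ this] obtain Y where
    Y: "Y \<subseteq> {..<n}" "card Y = s" and "left_independent ?M {..<s} Y" by auto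
  then have det: "det (submatrix (mat s n (\<lambda>(i, j). ?M i j)) {..<s} Y) \<noteq> 0"
    by (simp add: det_submatrix_neq_0_iff)
  from det_submatrix_neq_0_transversal[OF Y this] obtain \<sigma> where
    bij: "bij_betw \<sigma> {..<s} Y" and nz: "\<And>i. i < s \<Longrightarrow> ?M i (\<sigma> i) \<noteq> 0" by blast
  have \<sigma>_blk: "in_block L i (\<sigma> i)" and \<sigma>_zero: "?a i (\<sigma> i) = 0" if "i < s" for i
    using nz[OF that] by (auto simp: zero_part_def split: if_splits)
  have fin: "finite Y" using Y(1) finite_subset by blast
  have blk: "in_block L i (\<tau> i)"
    if "inj_on \<tau> {..<s}" "\<tau> ` {..<s} \<subseteq> Y" "\<And>i. i < s \<Longrightarrow> ?a i (\<tau> i) \<noteq> -\<infinity>" "i < s" for \<tau> i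
  proof (rule transversal_in_blocks[OF peel, of \<sigma>])
    show "\<tau> ` {..<s} \<subseteq> \<sigma> ` {..<s}" using that(2) bij by (simp add: bij_betw_def)
    show "?a i (\<sigma> i) \<noteq> -\<infinity>" if "i \<in> {..<s}" for i using \<sigma>_zero[of i] that by simp
  qed (use that bij \<sigma>_blk in \<open>auto simp: bij_betw_def\<close>)
  have "no_positive_transversal {..<s} Y"
    unfolding no_positive_transversal_def
  proof (intro allI impI ballI)
    fix \<tau> i
    assume \<tau>: "inj_on \<tau> {..<s} \<and> \<tau> ` {..<s} \<subseteq> Y \<and> (\<forall>i\<in>{..<s}. ?a i (\<tau> i) \<noteq> -\<infinity>)" and i: "i \<in> {..<s}"
    then have "in_block L i (\<tau> i)" by (intro blk) auto
    then obtain R0 D where "(R0, D) \<in> set L" "i \<in> R0" "\<tau> i \<in> D" by (auto simp: in_block_def)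
    from peeling_block_mem(2)[OF peel this] \<tau> i show "?a i (\<tau> i) = 0" by blast
  qed
  moreover have "zero_transversal {..<s} Y \<sigma>"
    using bij \<sigma>_zero by (simp add: zero_transversal_def bij_betw_def)
  ultimately have J: "jacobi_number ?a Y {..<s} = 0"
    using fin by (auto simp: jacobi_number_eq_0_iff)
  have "det (submatrix (mat s n (\<lambda>(i, j). ?g i j)) {..<s} Y) =
      det (submatrix (mat s n (\<lambda>(i, j). ?M i j)) {..<s} Y)"
  proof (rule det_submatrix_cong_transversals[OF Y])
    fix \<tau> assume \<tau>: "bij_betw \<tau> {..<s} Y"
    show "(\<forall>i<s. ?g i (\<tau> i) = ?M i (\<tau> i)) \<or> (\<exists>i<s. ?g i (\<tau> i) = 0) \<and> (\<exists>i<s. ?M i (\<tau> i) = 0)"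
    proof (cases "\<forall>i<s. ?a i (\<tau> i) = 0")
      case True
      then have "in_block L i (\<tau> i)" if "i < s" for i
        using \<tau> that by (intro blk) (auto simp: bij_betw_def)
      then show ?thesis by simp
    next
      case False
      then obtain i where "i < s" "?a i (\<tau> i) \<noteq> 0" by blast
      then have "?g i (\<tau> i) = 0" "?M i (\<tau> i) = 0" by (simp_all add: zero_part_def)
      with \<open>i < s\<close> show ?thesis by blast
    qed
  qed
  with det have "nabla s n U P Y z \<noteq> 0" by (simp add: nabla_eq_det_zero_part[OF Y J])
  with Y J show ?thesis unfolding obar_regular_def by blast
qed

section \<open>From regularity to full row ranks\<close>

text \<open>Entries outside a relation \<open>Q\<close> that contains all zero transversals do not affect \<open>\<nabla>\<close>, so they can be erased
  before looking for left kernel vectors.\<close>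

lemma left_independent_of_nabla:
  assumes Y: "Y \<subseteq> {..<n}" "card Y = s" and J: "jacobi_number (order_matrix U P) Y {..<s} = 0"
    and nz: "nabla s n U P Y z \<noteq> 0"
    and Q: "\<And>\<tau> i. bij_betw \<tau> {..<s} Y \<Longrightarrow> (\<And>i. i < s \<Longrightarrow> order_matrix U P i (\<tau> i) = 0) \<Longrightarrow> i < s \<Longrightarrow>
      Q i (\<tau> i)"
  shows "left_independent (\<lambda>i j. if Q i j then zero_part U P z i j else 0) {..<s} Y"
proof -
  let ?g = "zero_part U P z"
  let ?M = "\<lambda>i j. if Q i j then ?g i j else 0"
  have "det (submatrix (mat s n (\<lambda>(i, j). ?g i j)) {..<s} Y) =
      det (submatrix (mat s n (\<lambda>(i, j). ?M i j)) {..<s} Y)"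
  proof (rule det_submatrix_cong_transversals[OF Y])
    fix \<tau> assume \<tau>: "bij_betw \<tau> {..<s} Y"
    show "(\<forall>i<s. ?g i (\<tau> i) = ?M i (\<tau> i)) \<or> (\<exists>i<s. ?g i (\<tau> i) = 0) \<and> (\<exists>i<s. ?M i (\<tau> i) = 0)"
    proof (cases "\<forall>i<s. order_matrix U P i (\<tau> i) = 0")
      case True
      with Q[OF \<tau>] show ?thesis by simp
    next
      case False
      then obtain i where "i < s" "order_matrix U P i (\<tau> i) \<noteq> 0" by blast
      then have "?g i (\<tau> i) = 0" "?M i (\<tau> i) = 0" by (simp_all add: zero_part_def)
      with \<open>i < s\<close> show ?thesis by blast
    qed
  qed
  with nz have "det (submatrix (mat s n (\<lambda>(i, j). ?M i j)) {..<s} Y) \<noteq> 0"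
    by (simp add: nabla_eq_det_zero_part[OF Y J])
  then show ?thesis by (simp only: det_submatrix_neq_0_iff[OF Y])
qed

text \<open>A zero coordinate would leave a left kernel vector of a matrix with one row less.\<close>

lemma kernel_nonzero_everywhere:
  assumes fin: "finite R"
    and sub: "\<And>S. S \<subseteq> R \<Longrightarrow> card S = card R - 1 \<Longrightarrow> left_independent f S D"
    and v: "\<And>j. j \<in> D \<Longrightarrow> (\<Sum>i\<in>R. v i * f i j) = 0" and nz: "k \<in> R" "v k \<noteq> 0" and i: "i \<in> R"
  shows "v i \<noteq> 0"
proof
  assume "v i = 0"
  have "card (R - {i}) = card R - 1" using i fin by simp
  with sub have "left_independent f (R - {i}) D" by blast
  moreover have "(\<Sum>i\<in>R - {i}. v i * f i j) = 0" if "j \<in> D" for j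
    using v[OF that] sum.remove[OF fin i, of "\<lambda>i. v i * f i j"] \<open>v i = 0\<close> by simp
  ultimately have "v k = 0 \<or> k = i" using left_independentD[of f "R - {i}" D v k] nz by blast
  with \<open>v i = 0\<close> nz show False by auto
qed

text \<open>The case (b). Rows have the level \<open>l\<close> and columns the level of the row that \<open>\<sigma>\<close> sends to them; zero
  transversals preserve levels. Let \<open>w\<close> be the kernel vector \<open>v\<close> of the block, restricted to the rows \<open>I\<close> of
  minimal level in \<open>T\<close>. The entries between different levels are erased, so \<open>w\<close> annihilates the columns of other levels. A column
  of minimal level has its finite entries in the rows \<open>T\<close> within \<open>I\<close>, so it is a column of the block or
  it is \<open>-\<infinity>\<close> in all rows of \<open>T\<close>; in both cases \<open>w\<close> annihilates it.\<close>

lemma block_independent_of_regular: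
  assumes peel: "nat_order_matrix.peeling (order_matrix U P) n {..<s} L"
    and RD: "(R0, D) \<in> set L" and z: "z \<in> U"
    and sub: "\<And>S. S \<subseteq> R0 \<Longrightarrow> card S = card R0 - 1 \<Longrightarrow> left_independent (jac P z) S D"
    and Y: "Y \<subseteq> {..<n}" "card Y = s" and J: "jacobi_number (order_matrix U P) Y {..<s} = 0"
    and nz: "nabla s n U P Y z \<noteq> 0"
  shows "left_independent (jac P z) R0 D"
proof (rule ccontr)
  let ?a = "order_matrix U P" and ?g = "zero_part U P z"
  interpret nat_order_matrix ?a by (rule nat_order_matrix_order_matrix)
  assume "\<not> left_independent (jac P z) R0 D"
  then obtain v k0 where ker: "\<And>j. j \<in> D \<Longrightarrow> (\<Sum>i\<in>R0. v i * jac P z i j) = 0"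
    and k0: "k0 \<in> R0" "v k0 \<noteq> 0" unfolding left_independent_def by blast
  obtain k where k: "k < length L" "L ! k = (R0, D)" using RD by (auto simp: in_set_conv_nth)
  define T where "T = \<Union> (fst ` set (drop k L))"
  have "peeling n T ((R0, D) # drop (Suc k) L)"
    using peeling_drop[OF peel, of k] Cons_nth_drop_Suc[OF k(1)] k(2) by (simp add: T_def)
  note headT = peeling_head[OF this]
  from \<open>peeling n T ((R0, D) # drop (Suc k) L)\<close> obtain C0 where
    ne: "R0 \<noteq> {}" and can: "is_canonical ?a T (pure_columns n T) (R0, C0)"
    and D: "D = pure_columns n T - C0" by auto
  have T_sub: "T \<subseteq> {..<s}"
    using peeling_rows[OF peel] set_drop_subset[of k L] by (auto simp: T_def)
  then have R0_sub: "R0 \<subseteq> {..<s}" using headT(1) by blast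
  have finT: "finite T" and finR0: "finite R0" using T_sub R0_sub finite_subset by blast+
  have v_nz: "v i \<noteq> 0" if "i \<in> R0" for i
    by (rule kernel_nonzero_everywhere[OF finR0 sub ker k0 that])
  have finY: "finite Y" using Y(1) finite_subset by blast
  have npt: "no_positive_transversal {..<s} Y" using J finY by (simp add: jacobi_number_eq_0_iff)
  obtain \<sigma> where \<sigma>: "zero_transversal {..<s} Y \<sigma>" using J finY by (auto simp: jacobi_number_eq_0_iff)
  have bij: "bij_betw \<sigma> {..<s} Y" using bij_zero_transversal[OF finY _ _ \<sigma>] Y(2) by simp
  have zero: "\<And>i. i < s \<Longrightarrow> ?a i (\<sigma> i) = 0" using \<sigma> by (simp add: zero_transversal_def)
  define l where "l = min_canon ?a s Y"
  have pot: "potential {..<s} \<tau> l" if "bij_betw \<tau> {..<s} Y" "\<And>i. i < s \<Longrightarrow> ?a i (\<tau> i) = 0" for \<tau>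
    unfolding l_def by (rule min_canon_potential[OF that npt])
  have pot\<sigma>: "potential {..<s} \<sigma> l" by (rule pot[OF bij zero])
  define level where "level j = l (the_inv_into {..<s} \<sigma> j)" for j
  have level: "level (\<sigma> i) = l i" if "i < s" for i
    using bij that by (simp add: level_def bij_betw_def the_inv_into_f_f)
  have col: "\<exists>k<s. j = \<sigma> k" if "j \<in> Y" for j using bij that by (auto simp: bij_betw_def)
  have zero_le: "l i \<le> l k" if "potential {..<s} \<tau> l" "i < s" "k < s" "?a i (\<tau> k) = 0" for \<tau> i k
    using that unfolding potential_def by force
  let ?Q = "\<lambda>i j. l i = level j"
  have ind: "left_independent (\<lambda>i j. if ?Q i j then ?g i j else 0) {..<s} Y"
  proof (rule left_independent_of_nabla[OF Y J nz])
    fix \<tau> i assume \<tau>: "bij_betw \<tau> {..<s} Y" "\<And>i. i < s \<Longrightarrow> ?a i (\<tau> i) = 0" and i: "i < s"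
    have "\<tau> i \<in> Y" using \<tau>(1) i by (auto simp: bij_betw_def)
    then obtain k where k: "k < s" "\<tau> i = \<sigma> k" using col by blast
    have "l k \<le> l i" using zero_le[OF pot[OF \<tau>] k(1) i] zero[OF k(1)] k(2) by simp
    moreover have "l i \<le> l k" using zero_le[OF pot\<sigma> i k(1)] \<tau>(2)[OF i] k(2) by simp
    ultimately show "?Q i (\<tau> i)" using level[OF k(1)] k(2) by simp
  qed
  obtain i0 where i0: "i0 \<in> T" and min: "\<And>i. i \<in> T \<Longrightarrow> l i0 \<le> l i"
    using ex_has_least_nat[of "\<lambda>i. i \<in> T" _ l] ne headT(1) by blast
  define I where "I = {i\<in>T. l i = l i0}"
  have potT: "potential T \<sigma> l" by (rule potential_subset[OF pot\<sigma> T_sub])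
  have \<sigma>T: "zero_transversal T Y \<sigma>"
    using \<sigma> T_sub unfolding zero_transversal_def by (auto intro: inj_on_subset)
  have I_sub: "I \<subseteq> R0"
  proof
    fix i assume "i \<in> I"
    then show "i \<in> R0"
      using min by (intro minimal_rows_in_canonical_cover[OF finT \<sigma>T Y(1) potT can])
        (auto simp: I_def)
  qed
  \<comment> \<open>the vector to be exhibited in the left kernel of the matrix of equal levels\<close>
  define w where "w i = (if i \<in> I then v i else 0)" for i
  have "(\<Sum>i<s. w i * (if ?Q i j then ?g i j else 0)) = 0" if j: "j \<in> Y" for j
  proof (cases "level j = l i0")
    case False
    then show ?thesis by (intro sum.neutral) (auto simp: w_def I_def)
  next
    case True
    obtain k where k: "k < s" "j = \<sigma> k" using col[OF j] by blast
    have lk: "l k = l i0" using True level[OF k(1)] k(2) by simp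
    have in_I: "?a i j = 0 \<and> i \<in> I" if i: "i \<in> T" "?a i j \<noteq> -\<infinity>" for i
    proof -
      have "i < s" using i T_sub by auto
      then have "ordn i (\<sigma> k) + l i \<le> l k"
        using potential_finite_entry[OF pot\<sigma>, of i k] i k by simp
      with min[OF i(1)] lk have "ordn i j = 0" "l i = l i0" using k(2) by simp_all
      with finite_entry[OF i(2)] i(1) show ?thesis by (simp add: I_def)
    qed
    have "j \<notin> C0"
      using in_I I_sub by (intro column_outside_canonical_cover[OF finT can]) fastforce
    show ?thesis
    proof (cases "j \<in> D")
      case True
      have "(\<Sum>i<s. w i * (if ?Q i j then ?g i j else 0)) = (\<Sum>i\<in>R0. v i * jac P z i j)"
      proof (rule sum.mono_neutral_cong_right)
        show "\<forall>i\<in>{..<s} - R0. w i * (if ?Q i j then ?g i j else 0) = 0"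
          using I_sub by (auto simp: w_def)
        fix i assume i: "i \<in> R0"
        then have "i \<in> T" using headT(1) by blast
        show "w i * (if ?Q i j then ?g i j else 0) = v i * jac P z i j"
        proof (cases "i \<in> I")
          case True
          then have "?Q i j" using \<open>level j = l i0\<close> by (simp add: I_def)
          moreover have "?g i j = jac P z i j"
            using headT(4)[OF \<open>i \<in> T\<close> \<open>j \<in> D\<close>] by (rule zero_part_eq_jac[OF z])
          ultimately show ?thesis using True by (simp add: w_def)
        next
          case False
          with in_I[OF \<open>i \<in> T\<close>] have "?a i j = -\<infinity>" by blast
          with False show ?thesis by (simp add: w_def jac_eq_0[OF z])
        qed
      qed (use R0_sub in auto)
      then show ?thesis using ker[OF True] by simp
    next
      case False
      with \<open>j \<notin> C0\<close> D have "j \<notin> pure_columns n T" by blast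
      moreover have "j < n" using j Y(1) by auto
      moreover have "\<forall>i\<in>T. ?a i j = 0 \<or> ?a i j = -\<infinity>" using in_I by blast
      ultimately have "?a i j = -\<infinity>" if "i \<in> T" for i using that unfolding pure_columns_def by blast
      then have "?g i j = 0" if "i \<in> I" for i using that by (simp add: I_def zero_part_def)
      then show ?thesis by (intro sum.neutral) (auto simp: w_def)
    qed
  qed
  moreover have "i0 < s" using i0 T_sub by auto
  ultimately have "w i0 = 0" using left_independentD[OF ind, of w i0] by blast
  moreover have "i0 \<in> I" using i0 by (simp add: I_def)
  ultimately show False using v_nz I_sub by (auto simp: w_def)
qed

text \<open>The case (a): all zero transversals stay in the blocks, so the blocks can be isolated.\<close>

lemma dense_block_independent_of_regular:
  assumes bt: "block_triangular s n (order_matrix U P) p Sig Xi"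
    and dense: "\<forall>h\<in>{1..p}. \<forall>i\<in>Sig h. \<forall>j\<in>Xi h. order_matrix U P i j = 0"
    and h: "h \<in> {1..p}"
    and Y: "Y \<subseteq> {..<n}" "card Y = s" and J: "jacobi_number (order_matrix U P) Y {..<s} = 0"
    and nz: "nabla s n U P Y z \<noteq> 0"
  shows "left_independent (jac P z) (Sig h) (Xi h)"
  unfolding left_independent_def
proof (intro allI impI ballI)
  let ?a = "order_matrix U P" and ?g = "zero_part U P z"
  interpret nat_order_matrix ?a by (rule nat_order_matrix_order_matrix)
  fix v k assume ker: "\<forall>j\<in>Xi h. (\<Sum>i\<in>Sig h. v i * jac P z i j) = 0" and k: "k \<in> Sig h"
  have finY: "finite Y" using Y(1) finite_subset by blast
  have npt: "no_positive_transversal {..<s} Y" using J finY by (simp add: jacobi_number_eq_0_iff)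
  let ?Q = "\<lambda>i j. \<exists>h\<in>{1..p}. i \<in> Sig h \<and> j \<in> Xi h"
  have ind: "left_independent (\<lambda>i j. if ?Q i j then ?g i j else 0) {..<s} Y"
  proof (rule left_independent_of_nabla[OF Y J nz])
    fix \<tau> i assume \<tau>: "bij_betw \<tau> {..<s} Y" "\<And>i. i < s \<Longrightarrow> ?a i (\<tau> i) = 0" and i: "i < s"
    have "zero_transversal {..<s} {..<n} \<tau>"
      using \<tau> Y(1) by (auto simp: zero_transversal_def bij_betw_def)
    moreover have "potential {..<s} \<tau> (min_canon ?a s Y)"
      by (rule min_canon_potential[OF \<tau> npt])
    moreover obtain h' where "h' \<in> {1..p}" "i \<in> Sig h'"
      using i block_triangular_parts(2)[OF bt h] by blast
    ultimately show "?Q i (\<tau> i)" using dense_transversal_in_blocks[OF bt dense] by blast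
  qed
  have Q_iff: "?Q i j \<longleftrightarrow> j \<in> Xi h" if "i \<in> Sig h" for i j
    using block_triangular_block_eq[OF bt h _ that] that h by blast
  have Sig_sub: "Sig h \<subseteq> {..<s}" by (rule block_triangularD(2)[OF bt h])
  define w where "w i = (if i \<in> Sig h then v i else 0)" for i
  have "(\<Sum>i<s. w i * (if ?Q i j then ?g i j else 0)) = 0" for j
  proof -
    have "(\<Sum>i<s. w i * (if ?Q i j then ?g i j else 0))
        = (\<Sum>i\<in>Sig h. v i * (if j \<in> Xi h then jac P z i j else 0))"
    proof (rule sum.mono_neutral_cong_right)
      fix i assume i: "i \<in> Sig h"
      show "w i * (if ?Q i j then ?g i j else 0) = v i * (if j \<in> Xi h then jac P z i j else 0)"
        unfolding Q_iff[OF i] using i dense[rule_format, OF h i] by (simp add: w_def zero_part_def)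
    qed (use Sig_sub in \<open>auto simp: w_def\<close>)
    also have "\<dots> = 0" using ker by (cases "j \<in> Xi h") auto
    finally show ?thesis .
  qed
  from left_independentD[OF ind, of w k, OF this] k Sig_sub show "v k = 0" by (auto simp: w_def)
qed

section \<open>Regularity in terms of the blocks\<close>

lemma obar_steps_peeling:
  assumes "obar_system s n U P"
  shows "nat_order_matrix.peeling (order_matrix U P) n {..<s} (obar_steps s n U P)"
proof -
  interpret nat_order_matrix "order_matrix U P" by (rule nat_order_matrix_order_matrix)
  obtain Y where Y: "Y \<subseteq> {..<n}" "card Y = s" and J: "jacobi_number (order_matrix U P) Y {..<s} = 0"
    by (rule obar_system_optimal[OF assms])
  have finY: "finite Y" using Y(1) finite_subset by blast
  have npt: "no_positive_transversal {..<s} Y" using J finY by (simp add: jacobi_number_eq_0_iff)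
  obtain \<sigma> where \<sigma>: "zero_transversal {..<s} Y \<sigma>" using J finY by (auto simp: jacobi_number_eq_0_iff)
  have bij: "bij_betw \<sigma> {..<s} Y" using bij_zero_transversal[OF finY _ _ \<sigma>] Y(2) by simp
  have pot: "potential {..<s} \<sigma> (min_canon (order_matrix U P) s Y)"
    using \<sigma> by (intro min_canon_potential[OF bij _ npt]) (simp add: zero_transversal_def)
  have "zero_transversal {..<s} {..<n} \<sigma>" using \<sigma> Y(1) by (auto simp: zero_transversal_def)
  from obar_test_peeling[OF _ this pot, of "{..<n}"]
  show ?thesis by (auto simp: obar_steps_def)
qed

text \<open>Blocks are numbered from the last step backwards, from \<open>1\<close>.\<close>

lemma all_nth_rev_iff:
  "(\<forall>h\<in>{1..length L}. Q (L ! (length L - h))) \<longleftrightarrow> (\<forall>x\<in>set L. Q x)"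
proof
  assume A: "\<forall>h\<in>{1..length L}. Q (L ! (length L - h))"
  show "\<forall>x\<in>set L. Q x"
  proof
    fix x assume "x \<in> set L"
    then obtain k where k: "k < length L" "L ! k = x" by (auto simp: in_set_conv_nth)
    then have "length L - k \<in> {1..length L}" by auto
    from bspec[OF A this] k show "Q x" by simp
  qed
qed auto

lemma mat_rank_block_iff:
  assumes "S \<subseteq> {..<s}" "D \<subseteq> {..<n}"
  shows "mat_rank (submatrix (jac_matrix s n P z) S D) = card S \<longleftrightarrow> left_independent (jac P z) S D"
proof -
  have "jac_matrix s n P z = mat s n (\<lambda>(i, j). jac P z i j)"
    by (simp add: jac_matrix_def jac_def)
  then show ?thesis by (simp only: mat_rank_submatrix_iff[OF assms])
qed

theorem corollary81:
  fixes s n :: nat and U :: "jet set" and P :: "nat \<Rightarrow> jet \<Rightarrow> real" and \<eta> :: jet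
  assumes "openin (top_of_set (jets n)) U"
    and "\<forall>i<s. differential_function n U (P i)"
    and "\<eta> \<in> diffiety s n U P"
    and "obar_system s n U P"
    and "dense_block_triangular_system s n U P \<or>
      (\<forall>h\<in>{1..length (obar_steps s n U P)}. \<forall>S. S \<subseteq> eq_block s n U P h \<and>
         card S = card (eq_block s n U P h) - 1 \<longrightarrow>
         mat_rank (submatrix (jac_matrix s n P \<eta>) S (var_block s n U P h)) =
           card (eq_block s n U P h) - 1)"
  shows "obar_regular s n U P \<eta> \<longleftrightarrow>
    (\<forall>h\<in>{1..length (obar_steps s n U P)}.
       mat_rank (submatrix (jac_matrix s n P \<eta>) (eq_block s n U P h) (var_block s n U P h)) =
         card (eq_block s n U P h))"
proof -
  let ?a = "order_matrix U P" and ?L = "obar_steps s n U P" and ?J = "jac_matrix s n P \<eta>"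
  interpret nat_order_matrix ?a by (rule nat_order_matrix_order_matrix)
  have \<eta>: "\<eta> \<in> U" using assms(3) by (simp add: diffiety_def)
  note peel = obar_steps_peeling[OF assms(4)]
  have sub: "fst x \<subseteq> {..<s} \<and> snd x \<subseteq> {..<n}" if x: "x \<in> set ?L" for x
  proof -
    obtain R0 D where RD: "x = (R0, D)" by force
    obtain k where k: "k < length ?L" "?L ! k = (R0, D)" using x RD by (auto simp: in_set_conv_nth)
    have "peeling n (\<Union> (fst ` set (drop k ?L))) ((R0, D) # drop (Suc k) ?L)"
      using peeling_drop[OF peel, of k] Cons_nth_drop_Suc[OF k(1)] k(2) by simp
    from peeling_head(2)[OF this] peeling_rows[OF peel] x RD show ?thesis by auto
  qed
  have rank: "mat_rank (submatrix ?J S (snd x)) = card S \<longleftrightarrow> left_independent (jac P \<eta>) S (snd x)"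
    if "x \<in> set ?L" "S \<subseteq> fst x" for x S
    using sub[OF that(1)] that(2) by (intro mat_rank_block_iff) auto
  have "(\<forall>h\<in>{1..length ?L}.
      mat_rank (submatrix ?J (eq_block s n U P h) (var_block s n U P h)) = card (eq_block s n U P h))
    \<longleftrightarrow> (\<forall>x\<in>set ?L. mat_rank (submatrix ?J (fst x) (snd x)) = card (fst x))"
    unfolding eq_block_def var_block_def
    by (rule all_nth_rev_iff[of ?L "\<lambda>x. mat_rank (submatrix ?J (fst x) (snd x)) = card (fst x)"])
  also have "\<dots> \<longleftrightarrow> (\<forall>x\<in>set ?L. left_independent (jac P \<eta>) (fst x) (snd x))"
    using rank by blast
  also have "\<dots> \<longleftrightarrow> obar_regular s n U P \<eta>"
  proof
    assume ind: "\<forall>x\<in>set ?L. left_independent (jac P \<eta>) (fst x) (snd x)"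
    then show "obar_regular s n U P \<eta>"
      by (intro obar_regular_of_blocks[OF peel \<eta>]) auto
  next
    assume "obar_regular s n U P \<eta>"
    then obtain Y where Y: "Y \<subseteq> {..<n}" "card Y = s" and J: "jacobi_number ?a Y {..<s} = 0"
      and nz: "nabla s n U P Y \<eta> \<noteq> 0" unfolding obar_regular_def by blast
    show "\<forall>x\<in>set ?L. left_independent (jac P \<eta>) (fst x) (snd x)"
      using assms(5)
    proof
      assume "dense_block_triangular_system s n U P"
      then obtain p Sig Xi where bt: "block_triangular s n ?a p Sig Xi"
        and dense: "\<forall>h\<in>{1..p}. \<forall>i\<in>Sig h. \<forall>j\<in>Xi h. ?a i j = 0"
        unfolding dense_block_triangular_system_def by blast
      have "{..<s} = (\<Union>h\<in>{1..p}. Sig h)"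
        by (rule bt[unfolded block_triangular_def, THEN conjunct2, THEN conjunct1, symmetric])
      with peel have "peeling n (\<Union>h\<in>{1..p}. Sig h) ?L" by simp
      from dense_peeling[OF bt dense order_refl this]
      have "set ?L = (\<lambda>h. (Sig h, Xi h)) ` {1..<Suc p}" by (simp only: set_map set_rev set_upt)
      then show ?thesis
        using dense_block_independent_of_regular[OF bt dense _ Y J nz] by auto
    next
      assume near: "\<forall>h\<in>{1..length ?L}. \<forall>S. S \<subseteq> eq_block s n U P h \<and>
         card S = card (eq_block s n U P h) - 1 \<longrightarrow>
         mat_rank (submatrix ?J S (var_block s n U P h)) = card (eq_block s n U P h) - 1"
      have near': "\<forall>x\<in>set ?L. \<forall>S. S \<subseteq> fst x \<and> card S = card (fst x) - 1 \<longrightarrow>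
         mat_rank (submatrix ?J S (snd x)) = card (fst x) - 1"
        using near unfolding eq_block_def var_block_def
        by (rule all_nth_rev_iff[of ?L "\<lambda>x. \<forall>S. S \<subseteq> fst x \<and> card S = card (fst x) - 1 \<longrightarrow>
          mat_rank (submatrix ?J S (snd x)) = card (fst x) - 1", THEN iffD1])
      show ?thesis
      proof
        fix x assume x: "x \<in> set ?L"
        then have mem: "(fst x, snd x) \<in> set ?L" by simp
        show "left_independent (jac P \<eta>) (fst x) (snd x)"
        proof (rule block_independent_of_regular[OF peel mem \<eta> _ Y J nz])
          fix S assume S: "S \<subseteq> fst x" "card S = card (fst x) - 1"
          then have "mat_rank (submatrix ?J S (snd x)) = card S" using bspec[OF near' x] by simp
          then show "left_independent (jac P \<eta>) S (snd x)" by (simp only: rank[OF x S(1)])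
        qed
      qed
    qed
  qed
  finally show ?thesis by blast
qed

end
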